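(* Let $W=(w_n)_{n\ge 0}$ be a weight, i.e. $w_n\in[1,+\infty]$, $\sum_{n=0}^\infty \frac1{w_n}=1$, and $\frac1{w_n}=O(n^{-\infty})$ (that is, $\frac1{w_n}=O(n^{-K})$ for every $K>0$). Put $M_k=\sum_{n=0}^\infty \frac{n^{k/2}}{w_n}$ for $k\ge 0$; assume that $w_n<\infty$ for at least one $n\ge1$ (so that $M_k>0$ for all $k$), and that $$\sum_{k=1}^\infty \frac{M_{k-1}}{M_k}=\infty .$$ Define $$h(p)=\frac{M_{p-1}}{M_p}\ (p\ge 1),\qquad H(p)=\sum_{k=1}^p h(k),$$ $$h^{-1}(\epsilon)=\min\{p\ge 1 : h(p)\le \epsilon\},\qquad H^{-1}(R)=\min\{p\ge 0 : H(p)\ge R\},$$ where $p$ ranges over integers. For $A\ge 0$ let $$N_W(A)=\sup\left\{ n_f : f\in\mathfrak A_W,\ f\not\equiv 0,\ |f(0)|\ge e^{-A}\|f\|_W\right\},$$ where $n_f$ is the number of zeros of $f$ in the closed unit disc $\overline{\mathbb D}$, counted with multiplicity. Then for every $A\ge 0$ $$N_W(A)\le 300\; h\!\left(2\max\left(p(A),\,h^{-1}\!\left(\tfrac{1}{p(A)}\right)\right)\right)^{-2},\qquad\text{where } p(A)=H^{-1}\!\left(H(\lceil A+3\rceil)+25\sqrt A\right).$$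
   Context: $\mathbb D=\{z\in\mathbb C:|z|<1\}$. For a weight $W$ as in the claim, $\mathfrak A_W$ is the space of analytic functions $f(z)=\sum_{n=0}^\infty a_nz^n$ in $\mathbb D$ (complex $a_n$) with $\|f\|_W:=\sup_n |a_n|w_n<\infty$. Conventions: $1/\infty=0$, $0\cdot\infty=0$ (so $w_n=+\infty$ forces $a_n=0$), $0^0=1$ (so $M_0=1$); all $M_k$ are finite. For $f\in\mathfrak A_W$, every derivative $f^{(k)}$ is uniformly continuous in $\mathbb D$ and hence extends continuously to $\overline{\mathbb D}$; a point $z_0\in\overline{\mathbb D}$ (including $|z_0|=1$) is a zero of multiplicity $\mu$ if the (extended) derivatives satisfy $f^{(k)}(z_0)=0$ for $0\le k<\mu$ and $f^{(\mu)}(z_0)\ne 0$, and of infinite multiplicity if all derivatives vanish at $z_0$. The sequence $h(p)$ is non-increasing. If no $p\ge1$ satisfies $h(p)\le\epsilon$ (which can happen only if $w_n=+\infty$ for all large $n$), set $h^{-1}(\epsilon)=\infty$ and read $h(\infty)$ as $\lim_{p\to\infty}h(p)$. The supremum of the empty set is taken to be $0$. *)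

theory Defs
  imports "HOL-Complex_Analysis.Complex_Analysis" "HOL-Library.Landau_Symbols"
    "HOL-Library.Extended_Nonnegative_Real"
begin

text \<open>
  A weight takes values in \<open>[1, \<infinity>]\<close> and is modelled by \<^typ>\<open>nat \<Rightarrow> ennreal\<close>, where
  \<open>inverse \<infinity> = 0\<close> and \<open>0 * \<infinity> = 0\<close>.
\<close>

definition recip :: "(nat \<Rightarrow> ennreal) \<Rightarrow> nat \<Rightarrow> real" where
  "recip W n = enn2real (inverse (W n))"

definition is_weight :: "(nat \<Rightarrow> ennreal) \<Rightarrow> bool" where
  "is_weight W \<longleftrightarrow>
     (\<forall>n. 1 \<le> W n) \<and>
     (\<Sum>n. inverse (W n)) = 1 \<and>
     (\<forall>K::real. K > 0 \<longrightarrow> recip W \<in> O(\<lambda>n. real n powr (- K)))"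

text \<open>
  Here \<open>n\<^bsup>k/2\<^esup>\<close> is written as \<open>(sqrt n) ^ k\<close>, because \<open>0 powr 0 = 0\<close> in the library whereas the
  convention \<open>0\<^sup>0 = 1\<close> is needed for the term \<open>n = k = 0\<close>.  For a weight the series converges.
\<close>

definition moment :: "(nat \<Rightarrow> ennreal) \<Rightarrow> nat \<Rightarrow> real" where
  "moment W k = (\<Sum>n. sqrt (real n) ^ k * recip W n)"

text \<open>Only the values at \<open>p \<ge> 1\<close> are meaningful.\<close>

definition hfun :: "(nat \<Rightarrow> ennreal) \<Rightarrow> nat \<Rightarrow> real" where
  "hfun W p = moment W (p - 1) / moment W p"

definition Hfun :: "(nat \<Rightarrow> ennreal) \<Rightarrow> nat \<Rightarrow> real" where
  "Hfun W p = (\<Sum>k=1..p. hfun W k)"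

definition hext :: "(nat \<Rightarrow> ennreal) \<Rightarrow> enat \<Rightarrow> real" where
  "hext W p = (case p of enat q \<Rightarrow> hfun W q | \<infinity> \<Rightarrow> lim (hfun W))"

definition hinv :: "(nat \<Rightarrow> ennreal) \<Rightarrow> real \<Rightarrow> enat" where
  "hinv W \<epsilon> = (if \<exists>p\<ge>1. hfun W p \<le> \<epsilon> then enat (LEAST p. p \<ge> 1 \<and> hfun W p \<le> \<epsilon>) else \<infinity>)"

text \<open>The minimum exists for every \<open>R\<close> whenever \<^const>\<open>Hfun\<close> is unbounded.\<close>

definition Hinv :: "(nat \<Rightarrow> ennreal) \<Rightarrow> real \<Rightarrow> nat" where
  "Hinv W R = (LEAST p. Hfun W p \<ge> R)"

definition pfun :: "(nat \<Rightarrow> ennreal) \<Rightarrow> real \<Rightarrow> nat" where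
  "pfun W A = Hinv W (Hfun W (nat \<lceil>A + 3\<rceil>) + 25 * sqrt A)"

definition taylor_coeff :: "(complex \<Rightarrow> complex) \<Rightarrow> nat \<Rightarrow> complex" where
  "taylor_coeff f n = (deriv ^^ n) f 0 / fact n"

definition weighted_norm :: "(nat \<Rightarrow> ennreal) \<Rightarrow> (complex \<Rightarrow> complex) \<Rightarrow> ennreal" where
  "weighted_norm W f = (SUP n. ennreal (cmod (taylor_coeff f n)) * W n)"

text \<open>
  Functions are total in HOL; the values outside the open unit disc are irrelevant, and everything
  below depends only on the restriction to the open disc.
\<close>

definition weighted_space :: "(nat \<Rightarrow> ennreal) \<Rightarrow> (complex \<Rightarrow> complex) set" where
  "weighted_space W = {f. f holomorphic_on ball 0 1 \<and> weighted_norm W f < \<infinity>}"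

text \<open>
  The continuous extension of the \<open>k\<close>-th derivative to the closed disc; at interior points the
  limit is the derivative itself.
\<close>

definition ext_deriv :: "nat \<Rightarrow> (complex \<Rightarrow> complex) \<Rightarrow> complex \<Rightarrow> complex" where
  "ext_deriv k f z = Lim (at z within ball 0 1) ((deriv ^^ k) f)"

text \<open>The value is \<open>0\<close> at points of the closed disc that are not zeros.\<close>

definition zero_mult :: "(complex \<Rightarrow> complex) \<Rightarrow> complex \<Rightarrow> enat" where
  "zero_mult f z =
     (if \<forall>k. ext_deriv k f z = 0 then \<infinity> else enat (LEAST k. ext_deriv k f z \<noteq> 0))"

text \<open>The (possibly infinite) sum of the multiplicities over the closed disc.\<close>

definition num_zeros :: "(complex \<Rightarrow> complex) \<Rightarrow> enat" where
  "num_zeros f = (SUP F\<in>{F. finite F \<and> F \<subseteq> cball 0 1}. \<Sum>z\<in>F. zero_mult f z)"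

definition max_zeros :: "(nat \<Rightarrow> ennreal) \<Rightarrow> real \<Rightarrow> enat" where
  "max_zeros W A =
     Sup {num_zeros f | f. f \<in> weighted_space W \<and> (\<exists>z\<in>ball 0 1. f z \<noteq> 0) \<and>
            ennreal (cmod (f 0)) \<ge> ennreal (exp (- A)) * weighted_norm W f}"

end

(* Scale the norm of f to 1 and let f(z) = sum c_n z^n.  For a boundary point e^{i t} the function
   F(x) = sum c_n e^{i n t} cos(sqrt n x) of a real variable satisfies |F^(k)| <= M_k, and Gaussian
   averages of F with complex variance give back all values of f in the open disc.  By the maximum
   principle f is at least e^{-A} somewhere on |z| = e^{-pi}, so F is not too small on an interval of
   length comparable to sqrt A.  Bang's proof of the Denjoy--Carleman theorem propagates this to the
   point 0: some derivative F^(2j)(0) with 2j < p(A) is large.  That is an angular derivative of f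
   at e^{i t}, and dividing out zeros one by one shows that p zeros within distance r ~ p h^2 of
   e^{i t} would make it small.  Covering an annulus of width r/2 by 4 pi/r discs of radius r, and
   using Jensen's inequality in the remaining disc, bounds the number of zeros. *)

theory Submission
  imports Defs "HOL-Probability.Characteristic_Functions"
begin

section \<open>Division of rapidly converging power series\<close>

text \<open>Bang's argument applied to f itself on the circle would consume the ratios
  \<open>moment W (2 * k) / moment W (2 * k + 2)\<close>, whose sum can converge although the sum of
  all \<open>hfun W k\<close> diverges. The frequencies sqrt n gain the missing levels: F is even,
  so its odd derivatives vanish at 0 and only the even ones, which belong to f, have to be
  controlled. What is lost is the relation of F to values of f away from the boundary point. The
  Gaussian average restores it, since it turns cos (sqrt n x) into a multiple of exp (- n t) with Re
  t > 0. Only nonnegative n occur in f, and this is what makes square roots of the frequencies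
  available. Two ranges escape this argument. For A < ln 2 the tail of the Gaussian is not under
  control, but then the constant term dominates and there are no zeros at all. If no q satisfies
  h(q) <= 1/p, then h has a positive limit; this bounds the degree of f, and a polynomial has no
  more zeros than its degree.\<close>

definition rapid :: "(nat \<Rightarrow> complex) \<Rightarrow> bool" where
  "rapid a \<longleftrightarrow> (\<forall>k. summable (\<lambda>n. real (n choose k) * norm (a n)))"

text \<open>
  Derivatives are divided by \<open>k!\<close>: with this normalisation, division by a linear factor maps the
  bound of order \<open>k + 1\<close> to the bound of order \<open>k\<close> without any constant.
\<close>

definition hasse :: "nat \<Rightarrow> (nat \<Rightarrow> complex) \<Rightarrow> complex \<Rightarrow> complex" where
  "hasse k a z = (\<Sum>n. of_nat (n choose k) * a n * z ^ (n - k))"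

definition hasse_norm :: "nat \<Rightarrow> (nat \<Rightarrow> complex) \<Rightarrow> real" where
  "hasse_norm k a = (\<Sum>n. real (n choose k) * norm (a n))"

definition shift :: "(nat \<Rightarrow> complex) \<Rightarrow> nat \<Rightarrow> complex" where
  "shift b n = (case n of 0 \<Rightarrow> 0 | Suc m \<Rightarrow> b m)"

text \<open>The coefficients of the quotient by \<open>z - w\<close>, provided that \<open>w\<close> is a zero.\<close>

definition synth_div :: "(nat \<Rightarrow> complex) \<Rightarrow> complex \<Rightarrow> nat \<Rightarrow> complex" where
  "synth_div a w n = (\<Sum>i. a (n + 1 + i) * w ^ i)"

lemma shift_simps [simp]: "shift b 0 = 0" "shift b (Suc n) = b n"
  by (simp_all add: shift_def)

lemma rapidD: "rapid a \<Longrightarrow> summable (\<lambda>n. real (n choose k) * norm (a n))"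
  by (simp add: rapid_def)

lemma rapid_summable_norm: "rapid a \<Longrightarrow> summable (\<lambda>n. norm (a n))"
  using rapidD[of a 0] by simp

lemma norm_hasse_term:
  fixes a :: "nat \<Rightarrow> complex"
  assumes "norm z \<le> 1"
  shows "norm (of_nat (n choose k) * a n * z ^ (n - k)) \<le> real (n choose k) * norm (a n)"
  using assms by (simp add: norm_mult norm_power mult_left_le power_le_one mult_nonneg_nonneg)

lemma summable_hasse:
  assumes "rapid a" "norm z \<le> 1"
  shows "summable (\<lambda>n. norm (of_nat (n choose k) * a n * z ^ (n - k)))"
    and "summable (\<lambda>n. of_nat (n choose k) * a n * z ^ (n - k))"
proof -
  show "summable (\<lambda>n. norm (of_nat (n choose k) * a n * z ^ (n - k)))"
    by (rule summable_comparison_test_ev[OF _ rapidD[OF assms(1), of k]])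
       (use norm_hasse_term[OF assms(2)] in auto)
  then show "summable (\<lambda>n. of_nat (n choose k) * a n * z ^ (n - k))"
    by (rule summable_norm_cancel)
qed

lemma hasse_sums:
  assumes "rapid a" "norm z \<le> 1"
  shows "(\<lambda>n. of_nat (n choose k) * a n * z ^ (n - k)) sums hasse k a z"
  unfolding hasse_def using summable_hasse(2)[OF assms] by (rule summable_sums)

lemma norm_hasse_le:
  assumes "rapid a" "norm z \<le> 1"
  shows "norm (hasse k a z) \<le> hasse_norm k a"
proof -
  have "norm (hasse k a z) \<le> (\<Sum>n. norm (of_nat (n choose k) * a n * z ^ (n - k)))"
    unfolding hasse_def by (rule summable_norm[OF summable_hasse(1)[OF assms]])
  also have "\<dots> \<le> hasse_norm k a"
    unfolding hasse_norm_def
    by (intro suminf_le norm_hasse_term assms summable_hasse rapidD)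
  finally show ?thesis .
qed

lemma rapid_shift:
  assumes "rapid b" shows "rapid (shift b)"
  unfolding rapid_def
proof
  fix k
  have "summable (\<lambda>n. real (Suc n choose k) * norm (b n))"
  proof (cases k)
    case 0
    then show ?thesis using rapid_summable_norm[OF assms] by simp
  next
    case (Suc j)
    have "summable (\<lambda>n. real (n choose j) * norm (b n) + real (n choose Suc j) * norm (b n))"
      by (intro summable_add rapidD assms)
    then show ?thesis by (simp add: Suc algebra_simps)
  qed
  then show "summable (\<lambda>n. real (n choose k) * norm (shift b n))"
    by (subst summable_Suc_iff[symmetric]) simp
qed

lemma rapid_diff:
  assumes "rapid a" "rapid b"
  shows "rapid (\<lambda>n. a n - b n)"
  unfolding rapid_def
proof
  fix k
  have "summable (\<lambda>n. real (n choose k) * norm (a n) + real (n choose k) * norm (b n))"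
    by (intro summable_add rapidD assms)
  then show "summable (\<lambda>n. real (n choose k) * norm (a n - b n))"
    by (rule summable_comparison_test_ev[rotated])
       (auto simp: abs_mult norm_triangle_ineq4 mult_left_mono simp flip: distrib_left)
qed

lemma rapid_cmult:
  assumes "rapid a" shows "rapid (\<lambda>n. c * a n)"
  unfolding rapid_def
proof
  fix k
  show "summable (\<lambda>n. real (n choose k) * norm (c * a n))"
    using summable_mult[OF rapidD[OF assms, of k], of "norm c"] by (simp add: norm_mult mult_ac)
qed

lemma hasse_diff:
  assumes "rapid a" "rapid b" "norm z \<le> 1"
  shows "hasse k (\<lambda>n. a n - b n) z = hasse k a z - hasse k b z"
  unfolding hasse_def
  by (subst suminf_diff) (use summable_hasse(2)[OF assms(1,3)] summable_hasse(2)[OF assms(2,3)] in \<open>auto simp: algebra_simps\<close>)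

lemma hasse_cmult:
  assumes "rapid a" "norm z \<le> 1"
  shows "hasse k (\<lambda>n. c * a n) z = c * hasse k a z"
  unfolding hasse_def using suminf_mult[OF summable_hasse(2)[OF assms], of c k]
  by (simp add: mult_ac)

lemma hasse_shift_0:
  assumes "rapid b" "norm z \<le> 1"
  shows "hasse 0 (shift b) z = z * hasse 0 b z"
proof -
  have "(\<lambda>n. z * (b n * z ^ n)) sums (z * hasse 0 b z)"
    using sums_mult[OF hasse_sums[OF assms, of 0], of z] by simp
  then have "(\<lambda>n. shift b (Suc n) * z ^ Suc n) sums (z * hasse 0 b z)"
    by (simp add: mult_ac)
  then have "(\<lambda>n. shift b n * z ^ n) sums (z * hasse 0 b z)"
    by (subst (asm) sums_Suc_iff) simp
  then show ?thesis by (simp add: hasse_def sums_iff)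
qed

text \<open>Pascal's rule. This is the Leibniz rule for the product with z, and the normalisation by
  the factorial removes its numerical factor.\<close>

lemma hasse_shift_Suc:
  assumes "rapid b" "norm z \<le> 1"
  shows "hasse (Suc k) (shift b) z = z * hasse (Suc k) b z + hasse k b z"
proof -
  have "(\<lambda>n. z * (of_nat (n choose Suc k) * b n * z ^ (n - Suc k)) + of_nat (n choose k) * b n * z ^ (n - k))
     sums (z * hasse (Suc k) b z + hasse k b z)"
    by (intro sums_add sums_mult hasse_sums assms)
  also have "(\<lambda>n. z * (of_nat (n choose Suc k) * b n * z ^ (n - Suc k)) + of_nat (n choose k) * b n * z ^ (n - k))
     = (\<lambda>n. of_nat (Suc n choose Suc k) * shift b (Suc n) * z ^ (Suc n - Suc k))"
  proof
    fix n
    have "z * (of_nat (n choose Suc k) * b n * z ^ (n - Suc k)) = of_nat (n choose Suc k) * b n * z ^ (n - k)"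
    proof (cases "n \<ge> Suc k")
      case True
      then have "n - k = Suc (n - Suc k)" by simp
      then have "z ^ (n - k) = z * z ^ (n - Suc k)" by (simp only: power_Suc)
      then show ?thesis by simp
    qed (simp add: binomial_eq_0)
    then show "z * (of_nat (n choose Suc k) * b n * z ^ (n - Suc k)) + of_nat (n choose k) * b n * z ^ (n - k)
      = of_nat (Suc n choose Suc k) * shift b (Suc n) * z ^ (Suc n - Suc k)"
      by (simp add: algebra_simps)
  qed
  finally have "(\<lambda>n. of_nat (n choose Suc k) * shift b n * z ^ (n - Suc k)) sums (z * hasse (Suc k) b z + hasse k b z)"
    by (subst (asm) sums_Suc_iff) simp
  then show ?thesis by (simp add: hasse_def sums_iff)
qed

text \<open>The hockey-stick identity; it is the source of the shift from order k to order k + 1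
  under division.\<close>

lemma sum_choose_lessThan: "(\<Sum>n<i. n choose k) = i choose Suc k"
  by (induction i) auto

text \<open>Each coefficient of the quotient is at most a tail of the sum of norms of
  \<open>a\<close>. Exchanging the two summations leaves the hockey-stick sum as the weight of each
  \<open>a i\<close>.\<close>

lemma hasse_norm_synth_div:
  assumes "rapid a" "norm w \<le> 1"
  shows "summable (\<lambda>n. real (n choose k) * norm (synth_div a w n))"
    and "hasse_norm k (synth_div a w) \<le> hasse_norm (Suc k) a"
proof -
  have sa: "summable (\<lambda>i. norm (a i))" by (rule rapid_summable_norm[OF assms(1)])
  \<comment> \<open>The tail is written as a sum over all indices with a cut-off, so that the index
    set does not depend on n when the sums are exchanged.\<close>
  have bound: "norm (synth_div a w n) \<le> (\<Sum>i. if n < i then norm (a i) else 0)" for n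
  proof -
    have 1: "summable (\<lambda>i. norm (a (n + 1 + i)))"
      using summable_ignore_initial_segment[OF sa, of "n + 1"] by (simp add: add_ac)
    have 2: "norm (norm (a (n + 1 + i) * w ^ i)) \<le> norm (a (n + 1 + i))" for i
      using assms(2) by (simp add: norm_mult norm_power mult_left_le power_le_one)
    have 3: "summable (\<lambda>i. norm (a (n + 1 + i) * w ^ i))"
      by (rule summable_comparison_test'[OF 1]) (rule 2)
    have s: "summable (\<lambda>i. if n < i then norm (a i) else 0)"
      by (rule summable_comparison_test'[OF sa]) auto
    have "norm (synth_div a w n) \<le> (\<Sum>i. norm (a (n + 1 + i) * w ^ i))"
      unfolding synth_div_def by (rule summable_norm[OF 3])
    also have "\<dots> \<le> (\<Sum>i. norm (a (n + 1 + i)))"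
      using 2 by (intro suminf_le 3 1) simp
    also have "\<dots> = (\<Sum>i. if n < i + (n + 1) then norm (a (i + (n + 1))) else 0)"
      by (simp add: add_ac)
    also have "\<dots> = (\<Sum>i. if n < i then norm (a i) else 0)"
      using suminf_split_initial_segment[OF s, of "n + 1"] by simp
    finally show ?thesis .
  qed
  have partial: "(\<Sum>n<N. real (n choose k) * norm (synth_div a w n)) \<le> hasse_norm (Suc k) a" for N
  proof -
    have s: "summable (\<lambda>i. real (n choose k) * (if n < i then norm (a i) else 0))" for n
      by (intro summable_mult summable_comparison_test'[OF sa]) auto
    have "(\<Sum>n<N. real (n choose k) * norm (synth_div a w n))
        \<le> (\<Sum>n<N. real (n choose k) * (\<Sum>i. if n < i then norm (a i) else 0))"
      by (intro sum_mono mult_left_mono bound) auto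
    also have "\<dots> = (\<Sum>n<N. (\<Sum>i. real (n choose k) * (if n < i then norm (a i) else 0)))"
      by (intro sum.cong refl suminf_mult[symmetric] summable_comparison_test'[OF sa]) auto
    also have "\<dots> = (\<Sum>i. \<Sum>n<N. real (n choose k) * (if n < i then norm (a i) else 0))"
      by (rule suminf_sum[symmetric]) (rule s)
    also have "\<dots> \<le> hasse_norm (Suc k) a"
      unfolding hasse_norm_def
    proof (intro suminf_le summable_sum s rapidD assms(1))
      fix i
      have "(\<Sum>n<N. real (n choose k) * (if n < i then norm (a i) else 0))
          = (\<Sum>n\<in>{..<N} \<inter> {..<i}. real (n choose k)) * norm (a i)"
        unfolding sum_distrib_right by (subst sum.inter_restrict) (auto intro!: sum.cong)
      also have "\<dots> \<le> (\<Sum>n<i. real (n choose k)) * norm (a i)"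
        by (intro mult_right_mono sum_mono2) auto
      also have "\<dots> = real (i choose Suc k) * norm (a i)"
        by (simp flip: of_nat_sum add: sum_choose_lessThan)
      finally show "(\<Sum>n<N. real (n choose k) * (if n < i then norm (a i) else 0)) \<le> real (i choose Suc k) * norm (a i)" .
    qed
    finally show ?thesis .
  qed
  show s: "summable (\<lambda>n. real (n choose k) * norm (synth_div a w n))"
    by (rule summableI_nonneg_bounded[OF _ partial]) simp
  show "hasse_norm k (synth_div a w) \<le> hasse_norm (Suc k) a"
    unfolding hasse_norm_def[of k] by (rule suminf_le_const[OF s partial])
qed

lemma rapid_synth_div: "rapid a \<Longrightarrow> norm w \<le> 1 \<Longrightarrow> rapid (synth_div a w)"
  using hasse_norm_synth_div(1) by (auto simp: rapid_def)

text \<open>Horner's scheme: the tails T(m), the sums of a(m + i) w^i, satisfy T(m) = a(m) + w T(m +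
  1), and the quotient has coefficients T(m + 1). That w is a zero says T(0) = 0, which settles the
  lowest coefficient.\<close>

lemma synth_div_eq:
  assumes a: "rapid a" and w: "norm w \<le> 1" and zero: "hasse 0 a w = 0"
  shows "a n = shift (synth_div a w) n - w * synth_div a w n"
proof -
  have s: "summable (\<lambda>i. a i * w ^ i)" using summable_hasse(2)[OF a w, of 0] by simp
  have sm: "summable (\<lambda>i. a (m + i) * w ^ i)" for m
  proof (rule summable_comparison_test')
    show "summable (\<lambda>i. norm (a (m + i)))"
      using summable_ignore_initial_segment[OF rapid_summable_norm[OF a], of m] by (simp add: add_ac)
    show "norm (a (m + i) * w ^ i) \<le> norm (a (m + i))" for i
      using w by (simp add: norm_mult norm_power mult_left_le power_le_one)
  qed
  have step: "(\<Sum>i. a (m + i) * w ^ i) = a m + w * synth_div a w m" for m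
  proof -
    have "(\<Sum>i. a (m + i) * w ^ i) = a m + (\<Sum>i. a (m + Suc i) * w ^ Suc i)"
      using suminf_split_head[OF sm[of m]] by simp
    also have "(\<Sum>i. a (m + Suc i) * w ^ Suc i) = w * synth_div a w m"
      unfolding synth_div_def using suminf_mult[OF sm[of "m + 1"], of w] by (simp add: mult_ac)
    finally show ?thesis .
  qed
  show ?thesis
  proof (cases n)
    case 0
    then show ?thesis using step[of 0] zero by (simp add: hasse_def eq_neg_iff_add_eq_0)
  next
    case (Suc m)
    have "synth_div a w m = (\<Sum>i. a (Suc m + i) * w ^ i)" by (simp add: synth_div_def)
    also have "\<dots> = a (Suc m) + w * synth_div a w (Suc m)" by (rule step)
    finally show ?thesis using Suc by simp
  qed
qed

lemma hasse_synth_div: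
  assumes "rapid a" "norm w \<le> 1" "hasse 0 a w = 0" "norm z \<le> 1"
  shows "hasse 0 a z = (z - w) * hasse 0 (synth_div a w) z"
    and "hasse (Suc k) a z = (z - w) * hasse (Suc k) (synth_div a w) z + hasse k (synth_div a w) z"
proof -
  note b = rapid_synth_div[OF assms(1,2)]
  have a: "a = (\<lambda>n. shift (synth_div a w) n - w * synth_div a w n)"
    using synth_div_eq[OF assms(1-3)] by blast
  have *: "hasse k a z = hasse k (shift (synth_div a w)) z - w * hasse k (synth_div a w) z" for k
    by (subst a) (simp add: hasse_diff rapid_shift b rapid_cmult assms hasse_cmult)
  show "hasse 0 a z = (z - w) * hasse 0 (synth_div a w) z"
    unfolding * hasse_shift_0[OF b assms(4)] by (simp add: algebra_simps)
  show "hasse (Suc k) a z = (z - w) * hasse (Suc k) (synth_div a w) z + hasse k (synth_div a w) z"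
    unfolding * hasse_shift_Suc[OF b assms(4)] by (simp add: algebra_simps)
qed

section \<open>Zeros and Taylor coefficients\<close>

text \<open>Away from w the Leibniz formula can be solved for the quotient, order by order.\<close>

lemma zeros_synth_div_other:
  assumes "rapid a" "norm w \<le> 1" "hasse 0 a w = 0" "norm z \<le> 1" "z \<noteq> w"
    and "\<And>k. k < n \<Longrightarrow> hasse k a z = 0"
  shows "k < n \<Longrightarrow> hasse k (synth_div a w) z = 0"
proof (induction k)
  case 0
  then show ?case using hasse_synth_div(1)[OF assms(1-4)] assms(5,6) by simp
next
  case (Suc k)
  then show ?case using hasse_synth_div(2)[OF assms(1-4), of k] assms(5) assms(6)[OF Suc.prems] by simp
qed

text \<open>At w itself the first summand of the Leibniz formula vanishes, so every order drops by
  one.\<close>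

lemma zeros_synth_div_same:
  assumes "rapid a" "norm w \<le> 1" "hasse 0 a w = 0"
    and "\<And>k. k < n \<Longrightarrow> hasse k a w = 0" and "k < n - 1"
  shows "hasse k (synth_div a w) w = 0"
  using hasse_synth_div(2)[OF assms(1-3,2), of k] assms(4)[of "Suc k"] assms(5) by simp

lemma sum_eq_SucE:
  fixes \<mu> :: "'a \<Rightarrow> nat"
  assumes "finite F" "sum \<mu> F = Suc m"
  obtains w where "w \<in> F" "\<mu> w > 0" "sum (\<mu>(w := \<mu> w - 1)) F = m"
proof -
  have "\<exists>w\<in>F. \<mu> w > 0" using assms by (metis gr0I sum.neutral nat.distinct(1))
  then obtain w where w: "w \<in> F" "\<mu> w > 0" by blast
  have "sum (\<mu>(w := \<mu> w - 1)) F = (\<mu> w - 1) + sum \<mu> (F - {w})"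
    using assms w by (subst sum.remove[of _ w]) (auto intro!: sum.cong)
  moreover have "sum \<mu> F = \<mu> w + sum \<mu> (F - {w})"
    using assms w by (subst sum.remove[of _ w]) auto
  ultimately have "sum (\<mu>(w := \<mu> w - 1)) F = m" using assms w by linarith
  with w show ?thesis by (rule that)
qed

text \<open>A replacement for the remainder of Hermite interpolation, as Rolle's theorem fails for
  complex functions. Dividing out one zero w turns the bound of order m + 1 into one of order m; the
  factor z - w contributes r, and the two summands of the Leibniz formula recombine by Pascal's
  rule.\<close>

lemma norm_hasse_le_of_zeros:
  assumes "rapid a" "finite F" "F \<subseteq> cball 0 1" "norm z\<^sub>0 \<le> 1"
    and "\<And>z. z \<in> F \<Longrightarrow> dist z\<^sub>0 z \<le> r"
    and "\<And>z k. z \<in> F \<Longrightarrow> k < \<mu> z \<Longrightarrow> hasse k a z = 0"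
    and "sum \<mu> F = m" "j \<le> m"
  shows "norm (hasse j a z\<^sub>0) \<le> real (m choose j) * r ^ (m - j) * hasse_norm m a"
  using assms(1,6-)
proof (induction m arbitrary: a \<mu> j)
  case 0
  then show ?case using norm_hasse_le[OF 0(1) assms(4), of 0] by simp
next
  case (Suc m)
  show ?case
  proof (cases "j = Suc m")
    case True
    then show ?thesis using norm_hasse_le[OF Suc.prems(1) assms(4), of j] by simp
  next
    case False
    with Suc.prems have j: "j \<le> m" by simp
    obtain w where w: "w \<in> F" "\<mu> w > 0" "sum (\<mu>(w := \<mu> w - 1)) F = m"
      by (rule sum_eq_SucE[OF assms(2) Suc.prems(3)])
    have w1: "norm w \<le> 1" using w assms(3) by auto
    have w0: "hasse 0 a w = 0" using Suc.prems(2) w by blast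
    let ?b = "synth_div a w"
    have rb: "rapid ?b" by (rule rapid_synth_div[OF Suc.prems(1) w1])
    have zb: "hasse k ?b z = 0" if "z \<in> F" "k < (\<mu>(w := \<mu> w - 1)) z" for z k
    proof (cases "z = w")
      case True
      then show ?thesis using zeros_synth_div_same[OF Suc.prems(1) w1 w0, of "\<mu> w" k] Suc.prems(2) that by auto
    next
      case False
      then show ?thesis
        using zeros_synth_div_other[OF Suc.prems(1) w1 w0, of z "\<mu> z" k] Suc.prems(2) that assms(3) by auto
    qed
    have r: "norm (z\<^sub>0 - w) \<le> r" using assms(5)[OF w(1)] by (simp add: dist_norm)
    then have r0: "r \<ge> 0" using norm_ge_zero order_trans by blast
    have IH: "norm (hasse i ?b z\<^sub>0) \<le> real (m choose i) * r ^ (m - i) * hasse_norm (Suc m) a" if "i \<le> m" for i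
    proof -
      have "norm (hasse i ?b z\<^sub>0) \<le> real (m choose i) * r ^ (m - i) * hasse_norm m ?b"
        by (rule Suc.IH[OF rb zb w(3) that])
      also have "\<dots> \<le> real (m choose i) * r ^ (m - i) * hasse_norm (Suc m) a"
        using r0 by (intro mult_left_mono hasse_norm_synth_div(2)[OF Suc.prems(1) w1]) auto
      finally show ?thesis .
    qed
    have main: "norm ((z\<^sub>0 - w) * hasse j ?b z\<^sub>0) \<le> real (m choose j) * r ^ (Suc m - j) * hasse_norm (Suc m) a"
    proof -
      have "norm ((z\<^sub>0 - w) * hasse j ?b z\<^sub>0) \<le> r * (real (m choose j) * r ^ (m - j) * hasse_norm (Suc m) a)"
        unfolding norm_mult by (intro mult_mono r IH j r0) auto
      also have "\<dots> = real (m choose j) * r ^ (Suc m - j) * hasse_norm (Suc m) a"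
        using j by (simp add: Suc_diff_le)
      finally show ?thesis .
    qed
    show ?thesis
    proof (cases j)
      case 0
      then show ?thesis using main hasse_synth_div(1)[OF Suc.prems(1) w1 w0 assms(4)] by simp
    next
      case (Suc i)
      have "norm (hasse j a z\<^sub>0) \<le> norm ((z\<^sub>0 - w) * hasse j ?b z\<^sub>0) + norm (hasse i ?b z\<^sub>0)"
        unfolding Suc hasse_synth_div(2)[OF Suc.prems(1) w1 w0 assms(4)] by (rule norm_triangle_ineq)
      also have "\<dots> \<le> real (m choose j) * r ^ (Suc m - j) * hasse_norm (Suc m) a
          + real (m choose i) * r ^ (Suc m - j) * hasse_norm (Suc m) a"
        using main IH[of i] j Suc by (intro add_mono) auto
      also have "\<dots> = real (Suc m choose j) * r ^ (Suc m - j) * hasse_norm (Suc m) a"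
        by (simp add: Suc algebra_simps)
      finally show ?thesis .
    qed
  qed
qed

section \<open>Continuity up to the boundary and derivatives inside the disc\<close>

lemma continuous_on_hasse:
  assumes "rapid a"
  shows "continuous_on (cball 0 1) (hasse k a)"
proof -
  have "uniform_limit (cball 0 1) (\<lambda>N z. \<Sum>n<N. of_nat (n choose k) * a n * z ^ (n - k)) (hasse k a) sequentially"
    unfolding hasse_def
    by (rule Weierstrass_m_test[OF _ rapidD[OF assms]]) (use norm_hasse_term in auto)
  then show ?thesis
    by (rule uniform_limit_theorem[rotated]) (auto intro!: always_eventually continuous_intros)
qed

lemma hasse_has_field_derivative:
  assumes "rapid a" "norm z < 1"
  shows "(hasse k a has_field_derivative of_nat (Suc k) * hasse (Suc k) a z) (at z)"
proof -
  \<comment> \<open>The exponent n - k is truncated for n < k, so the sum is reindexed to a genuine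
    power series; the dropped terms have binomial coefficient 0.\<close>
  define c where "c n = of_nat (n + k choose k) * a (n + k)" for n
  have reindex: "hasse j a x = (\<Sum>n. of_nat (n + j choose j) * a (n + j) * x ^ n)" if "norm x \<le> 1" for x j
    unfolding hasse_def
    using suminf_split_initial_segment[OF summable_hasse(2)[OF assms(1) that, of j], of j]
    by (simp add: binomial_eq_0)
  have "summable (\<lambda>n. c n * 1 ^ n)"
    using summable_ignore_initial_segment[OF summable_hasse(2)[OF assms(1), of 1 k], of k] by (simp add: c_def)
  then have "((\<lambda>x. \<Sum>n. c n * x ^ n) has_field_derivative (\<Sum>n. diffs c n * z ^ n)) (at z)"
    by (rule termdiffs_strong) (use assms in simp)
  also have "(\<Sum>n. diffs c n * z ^ n) = (\<Sum>n. of_nat (Suc k) * (of_nat (n + Suc k choose Suc k) * a (n + Suc k) * z ^ n))"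
  proof (rule suminf_cong)
    fix n
    have "Suc n * (Suc n + k choose k) = Suc k * (n + Suc k choose Suc k)"
      using Suc_times_binomial_add[of k n] by (simp only: add_Suc add_Suc_right add.commute)
    then have "of_nat (Suc n) * of_nat (Suc n + k choose k) = (of_nat (Suc k) * of_nat (n + Suc k choose Suc k) :: complex)"
      by (metis of_nat_mult)
    then show "diffs c n * z ^ n = of_nat (Suc k) * (of_nat (n + Suc k choose Suc k) * a (n + Suc k) * z ^ n)"
      unfolding diffs_def c_def by (simp only: mult.assoc[symmetric] add_Suc add_Suc_right)
  qed
  also have "\<dots> = of_nat (Suc k) * hasse (Suc k) a z"
  proof -
    have "summable (\<lambda>n. of_nat (n + Suc k choose Suc k) * a (n + Suc k) * z ^ n)"
      using summable_ignore_initial_segment[OF summable_hasse(2)[OF assms(1), of z "Suc k"], of "Suc k"] assms by simp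
    then show ?thesis using assms by (subst suminf_mult) (simp_all add: reindex)
  qed
  finally show ?thesis
  proof (rule has_field_derivative_transform_within_open)
    show "z \<in> ball 0 1" using assms by simp
    show "\<And>x. x \<in> ball 0 1 \<Longrightarrow> (\<Sum>n. c n * x ^ n) = hasse k a x"
      by (simp add: reindex c_def)
  qed simp
qed

lemma holomorphic_hasse:
  assumes "rapid a" shows "hasse k a holomorphic_on ball 0 1"
proof (rule holomorphic_onI)
  fix z :: complex assume "z \<in> ball 0 1"
  then have "norm z < 1" by simp
  from hasse_has_field_derivative[OF assms this, of k]
  show "hasse k a field_differentiable at z within ball 0 1"
    unfolding field_differentiable_def by (blast intro: has_field_derivative_at_within)
qed

lemma higher_deriv_eq_hasse:
  assumes "rapid a" and f: "\<And>z. z \<in> ball 0 1 \<Longrightarrow> f z = hasse 0 a z" and "z \<in> ball 0 1"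
  shows "(deriv ^^ k) f z = fact k * hasse k a z"
  using assms(3)
proof (induction k arbitrary: z)
  case 0
  then show ?case by (simp add: f)
next
  case (Suc k)
  have "eventually (\<lambda>x. x \<in> ball 0 1) (nhds z)"
    using Suc.prems by (intro eventually_nhds_in_open) auto
  then have "deriv ((deriv ^^ k) f) z = deriv (\<lambda>x. fact k * hasse k a x) z"
    by (intro deriv_cong_ev refl) (auto elim!: eventually_mono simp: Suc.IH)
  also have "\<dots> = fact k * (of_nat (Suc k) * hasse (Suc k) a z)"
    using Suc.prems by (intro DERIV_imp_deriv DERIV_cmult hasse_has_field_derivative assms(1)) simp
  finally show ?case by (simp add: algebra_simps)
qed

text \<open>On the unit circle \<open>1 - cnj w * z\<close> has the same modulus as the linear factor \<open>z - w\<close> it replaces.\<close>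

lemma norm_coeff_0_le_of_zeros:
  assumes "rapid a" "finite F" "F \<subseteq> cball 0 \<rho>" "\<rho> \<le> 1"
    and "\<And>z k. z \<in> F \<Longrightarrow> k < \<mu> z \<Longrightarrow> hasse k a z = 0"
    and "\<And>z. norm z = 1 \<Longrightarrow> norm (hasse 0 a z) \<le> B"
  shows "norm (a 0) \<le> \<rho> ^ sum \<mu> F * B"
  using assms(1,5,6)
proof (induction "sum \<mu> F" arbitrary: a \<mu>)
  case 0
  have "norm (hasse 0 a 0) \<le> B"
  proof (rule maximum_modulus_frontier[where f = "hasse 0 a" and S = "ball 0 1" and \<xi> = 0])
    show "hasse 0 a holomorphic_on interior (ball 0 1)" using holomorphic_hasse[OF "0.prems"(1)] by simp
    show "continuous_on (closure (ball 0 1)) (hasse 0 a)" using continuous_on_hasse[OF "0.prems"(1)] by simp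
    show "norm (hasse 0 a z) \<le> B" if "z \<in> frontier (ball 0 1)" for z
      using "0.prems"(3) that by simp
  qed auto
  moreover have "hasse 0 a 0 = a 0"
    by (simp add: hasse_def powser_zero)
  ultimately show ?case using 0 by simp
next
  case (Suc m)
  obtain w where w: "w \<in> F" "\<mu> w > 0" "sum (\<mu>(w := \<mu> w - 1)) F = m"
    by (rule sum_eq_SucE[OF assms(2) Suc.hyps(2)[symmetric]])
  have w\<rho>: "norm w \<le> \<rho>" and w1: "norm w \<le> 1" using w assms(3,4) by auto
  then have \<rho>: "\<rho> \<ge> 0" using norm_ge_zero order_trans by blast
  have w0: "hasse 0 a w = 0" using Suc.prems(2) w by blast
  let ?b = "synth_div a w"
  \<comment> \<open>The coefficients of f(z) (1 - cnj w z) / (z - w): one Blaschke factor is divided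
    out. The sequence remains rapid, and the constant term of f is - w times the new one, which
    supplies one factor \<rho>.\<close>
  define c where "c n = ?b n - cnj w * shift ?b n" for n
  have rb: "rapid ?b" by (rule rapid_synth_div[OF Suc.prems(1) w1])
  have rc: "rapid c" unfolding c_def by (intro rapid_diff rapid_cmult rapid_shift rb)
  have c0: "hasse 0 c z = (1 - cnj w * z) * hasse 0 ?b z" if "norm z \<le> 1" for z
    unfolding c_def using that rb
    by (simp add: hasse_diff rapid_cmult rapid_shift hasse_cmult hasse_shift_0 algebra_simps)
  have cS: "hasse (Suc k) c z = (1 - cnj w * z) * hasse (Suc k) ?b z - cnj w * hasse k ?b z" if "norm z \<le> 1" for z k
    unfolding c_def using that rb
    by (simp add: hasse_diff rapid_cmult rapid_shift hasse_cmult hasse_shift_Suc algebra_simps)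
  have zb: "hasse k ?b z = 0" if "z \<in> F" "k < (\<mu>(w := \<mu> w - 1)) z" for z k
  proof (cases "z = w")
    case True
    then show ?thesis using zeros_synth_div_same[OF Suc.prems(1) w1 w0, of "\<mu> w" k] Suc.prems(2) that by auto
  next
    case False
    have "norm z \<le> 1" using that assms(3,4) by force
    with False show ?thesis
      using zeros_synth_div_other[OF Suc.prems(1) w1 w0, of z "\<mu> z" k] Suc.prems(2) that by auto
  qed
  have zc: "hasse k c z = 0" if "z \<in> F" "k < (\<mu>(w := \<mu> w - 1)) z" for z k
  proof -
    have z: "norm z \<le> 1" using that assms(3,4) by force
    show ?thesis
    proof (cases k)
      case 0
      then show ?thesis using zb that by (simp add: c0[OF z])
    next
      case (Suc i)
      then have "i < (\<mu>(w := \<mu> w - 1)) z" using that by simp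
      then show ?thesis unfolding Suc cS[OF z] using zb[OF that(1)] that(2) Suc by simp
    qed
  qed
  have Bc: "norm (hasse 0 c z) \<le> B" if "norm z = 1" for z
  proof -
    have "z * cnj z = 1" using that by (simp add: complex_norm_square[symmetric])
    then have "1 - cnj w * z = z * cnj (z - w)" by (simp add: algebra_simps)
    then have "norm (1 - cnj w * z) = norm (z - w)" by (metis complex_mod_cnj mult_1 norm_mult that)
    then have "norm (hasse 0 c z) = norm (hasse 0 a z)"
      using that by (simp add: c0 hasse_synth_div(1)[OF Suc.prems(1) w1 w0] norm_mult)
    then show ?thesis using Suc.prems(3)[OF that] by simp
  qed
  have IH: "norm (c 0) \<le> \<rho> ^ m * B"
    using Suc.hyps(1)[OF w(3)[symmetric] rc zc Bc] w(3) by simp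
  have "a 0 = - w * c 0"
    using synth_div_eq[OF Suc.prems(1) w1 w0, of 0] by (simp add: c_def)
  then have "norm (a 0) = norm w * norm (c 0)" by (simp add: norm_mult)
  also have "\<dots> \<le> \<rho> * (\<rho> ^ m * B)"
    using w\<rho> IH \<rho> by (intro mult_mono) auto
  finally show ?case using Suc.hyps(2) by (metis mult.assoc power_Suc)
qed

section \<open>Gaussian integrals of complex variance\<close>

lemma integrable_exp_neg_square:
  fixes \<alpha> :: real
  assumes "\<alpha> > 0"
  shows "integrable lborel (\<lambda>x. exp (- \<alpha> * x\<^sup>2))"
    and "(\<integral>x. exp (- \<alpha> * x\<^sup>2) \<partial>lborel) = sqrt (pi / \<alpha>)"
proof -
  define \<sigma> where "\<sigma> = 1 / sqrt (2 * \<alpha>)"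
  have \<sigma>: "\<sigma> > 0" "\<sigma>\<^sup>2 = 1 / (2 * \<alpha>)"
    using assms by (auto simp: \<sigma>_def power_divide)
  have *: "exp (- \<alpha> * x\<^sup>2) = sqrt (pi / \<alpha>) * normal_density 0 \<sigma> x" for x
    using assms by (simp add: normal_density_def \<sigma> real_sqrt_divide)
  show "integrable lborel (\<lambda>x. exp (- \<alpha> * x\<^sup>2))"
    unfolding * using \<sigma> by (intro integrable_mult_right integrable_normal_density)
  show "(\<integral>x. exp (- \<alpha> * x\<^sup>2) \<partial>lborel) = sqrt (pi / \<alpha>)"
    unfolding * using \<sigma> integral_normal_density by simp
qed

lemma norm_exp_gauss: "cmod (exp (\<i> * of_real y - b * of_real x ^ 2)) = exp (- Re b * x\<^sup>2)"
  by (simp add: norm_exp_eq_Re flip: of_real_power)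

lemma integrable_gauss_exp:
  assumes "Re b > 0"
  shows "integrable lborel (\<lambda>x. exp (\<i> * of_real (l * x) - b * of_real x ^ 2))"
proof (rule Bochner_Integration.integrable_bound[OF integrable_exp_neg_square(1)[OF assms]])
  show "AE x in lborel. norm (exp (\<i> * complex_of_real (l * x) - b * (complex_of_real x)\<^sup>2))
      \<le> norm (exp (- Re b * x\<^sup>2))"
    unfolding norm_exp_gauss by simp
qed simp

text \<open>The characteristic function of the standard normal distribution after the substitution x
  -> sqrt (2 \<beta>) x.\<close>

lemma integral_gauss_exp_real:
  assumes "\<beta> > 0"
  shows "(\<integral>x. exp (\<i> * of_real (l * x) - of_real \<beta> * of_real x ^ 2) \<partial>lborel)
     = of_real (sqrt (pi / \<beta>) * exp (- l\<^sup>2 / (4 * \<beta>)))"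
proof -
  define c where "c = sqrt (2 * \<beta>)"
  have c: "c > 0" "c\<^sup>2 = 2 * \<beta>" using assms by (auto simp: c_def)
  define t where "t = l / c"
  have "of_real (exp (- (t\<^sup>2) / 2)) = char std_normal_distribution t"
    by (simp add: char_std_normal_distribution)
  also have "\<dots> = (\<integral>x. std_normal_density x *\<^sub>R iexp (t * x) \<partial>lborel)"
    unfolding char_def by (subst integral_density) auto
  also have "\<dots> = c *\<^sub>R (\<integral>x. std_normal_density (c * x) *\<^sub>R iexp (t * (c * x)) \<partial>lborel)"
    using c by (subst lborel_integral_real_affine[where c = c and t = 0]) auto
  also have "(\<lambda>x. std_normal_density (c * x) *\<^sub>R iexp (t * (c * x)))
     = (\<lambda>x. (1 / sqrt (2 * pi)) *\<^sub>R exp (\<i> * of_real (l * x) - of_real \<beta> * of_real x ^ 2))"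
  proof
    fix x
    have "- (c * x)\<^sup>2 / 2 = - (\<beta> * x\<^sup>2)" using c by (simp add: power_mult_distrib)
    then have 1: "std_normal_density (c * x) = 1 / sqrt (2 * pi) * exp (- (\<beta> * x\<^sup>2))"
      by (simp only: std_normal_density_def)
    have 2: "t * (c * x) = l * x" using c by (simp add: t_def)
    have "exp (\<i> * of_real (l * x) - of_real \<beta> * of_real x ^ 2)
        = iexp (l * x) * of_real (exp (- (\<beta> * x\<^sup>2)))"
      by (simp add: exp_diff exp_minus field_simps flip: of_real_power exp_of_real of_real_mult)
    then show "std_normal_density (c * x) *\<^sub>R iexp (t * (c * x))
       = (1 / sqrt (2 * pi)) *\<^sub>R exp (\<i> * of_real (l * x) - of_real \<beta> * of_real x ^ 2)"
      unfolding 1 2 scaleR_conv_of_real by simp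
  qed
  also have "c *\<^sub>R (\<integral>x. (1 / sqrt (2 * pi)) *\<^sub>R exp (\<i> * of_real (l * x) - of_real \<beta> * of_real x ^ 2) \<partial>lborel)
    = of_real (c / sqrt (2 * pi)) * (\<integral>x. exp (\<i> * of_real (l * x) - of_real \<beta> * of_real x ^ 2) \<partial>lborel)"
    by (simp add: scaleR_conv_of_real)
  finally have *: "of_real (c / sqrt (2 * pi)) * (\<integral>x. exp (\<i> * of_real (l * x) - of_real \<beta> * of_real x ^ 2) \<partial>lborel)
     = complex_of_real (exp (- (t\<^sup>2) / 2))" by simp
  have "(\<integral>x. exp (\<i> * of_real (l * x) - of_real \<beta> * of_real x ^ 2) \<partial>lborel)
     = of_real (sqrt (2 * pi) / c) * (of_real (c / sqrt (2 * pi)) * (\<integral>x. exp (\<i> * of_real (l * x) - of_real \<beta> * of_real x ^ 2) \<partial>lborel))"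
    using c by (simp only: mult.assoc[symmetric] of_real_mult[symmetric]) simp
  also have "\<dots> = of_real (sqrt (2 * pi) / c * exp (- (t\<^sup>2) / 2))"
    unfolding * by simp
  also have "sqrt (2 * pi) / c = sqrt (pi / \<beta>)"
    by (simp add: c_def real_sqrt_divide real_sqrt_mult)
  also have "- (t\<^sup>2) / 2 = - l\<^sup>2 / (4 * \<beta>)"
    using c by (simp add: t_def power_divide)
  finally show ?thesis .
qed

text \<open>The integrals over [-n, n] are holomorphic by differentiation under the integral sign.
  They converge locally uniformly, because on a half-plane Re b >= \<alpha> > 0 all tails are
  dominated by the tail of one real Gaussian.\<close>

lemma holomorphic_gauss_exp:
  "(\<lambda>b. \<integral>x. exp (\<i> * of_real (l * x) - b * of_real x ^ 2) \<partial>lborel) holomorphic_on {b. Re b > 0}"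
proof -
  let ?f = "\<lambda>b x. exp (\<i> * of_real (l * x) - b * of_real x ^ 2)"
  let ?U = "{b. Re b > 0}"
  let ?G = "\<lambda>n b. integral (cbox (- real n) (real n)) (?f b)"
  have U: "open ?U" "convex ?U"
    by (auto simp: open_halfspace_Re_gt convex_halfspace_Re_gt)
  show ?thesis
  proof (rule holomorphic_uniform_sequence[where f = ?G])
    show "open ?U" by fact
    show "?G n holomorphic_on ?U" for n
    proof (rule leibniz_rule_holomorphic[where fx = "\<lambda>b x. - (of_real x ^ 2) * ?f b x"])
      show "((\<lambda>b. ?f b x) has_field_derivative - (of_real x ^ 2) * ?f b x) (at b within ?U)" for b x
        by (auto intro!: derivative_eq_intros)
      show "?f b integrable_on cbox (- real n) (real n)" for b
        by (intro integrable_continuous continuous_intros)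
      show "continuous_on (?U \<times> cbox (- real n) (real n)) (\<lambda>(b, x). - (of_real x ^ 2) * ?f b x)"
        by (auto simp: case_prod_beta intro!: continuous_intros)
    qed fact
    fix b assume "b \<in> ?U"
    then have b: "Re b > 0" by simp
    \<comment> \<open>Half of Re b, so that the closed disc of radius \<alpha> about b stays in the
      half-plane where the tails are uniform.\<close>
    define \<alpha> where "\<alpha> = Re b / 2"
    have \<alpha>: "\<alpha> > 0" using b by (simp add: \<alpha>_def)
    define T where "T = (\<lambda>n::nat. \<integral>x. indicator (- {- real n..real n}) x * exp (- \<alpha> * x\<^sup>2) \<partial>lborel)"
    have T0: "T \<longlonglongrightarrow> 0"
    proof -
      have "T \<longlonglongrightarrow> (\<integral>x. 0 \<partial>(lborel::real measure))"
        unfolding T_def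
      proof (rule integral_dominated_convergence[where w = "\<lambda>x. exp (- \<alpha> * x\<^sup>2)"])
        show "AE x in lborel. (\<lambda>n. indicator (- {- real n..real n}) x * exp (- \<alpha> * x\<^sup>2)) \<longlonglongrightarrow> 0"
        proof (intro AE_I2 tendsto_eventually)
          fix x :: real
          obtain N where N: "\<bar>x\<bar> \<le> real N" using real_arch_simple by blast
          show "eventually (\<lambda>n. indicator (- {- real n..real n}) x * exp (- \<alpha> * x\<^sup>2) = 0) sequentially"
            using eventually_ge_at_top[of N]
            by eventually_elim (use N in \<open>auto simp: indicator_def\<close>)
        qed
        show "integrable lborel (\<lambda>x. exp (- \<alpha> * x\<^sup>2))"
          by (rule integrable_exp_neg_square(1)[OF \<alpha>])
      qed (auto simp: indicator_def)
      then show ?thesis by simp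
    qed
    have bound: "dist (?G n c) (\<integral>x. ?f c x \<partial>lborel) \<le> T n" if "Re c \<ge> \<alpha>" for c n
    proof -
      have c: "Re c > 0" using that \<alpha> by linarith
      have i: "set_integrable lborel {- real n..real n} (?f c)"
        using integrable_gauss_exp[OF c, of l] unfolding set_integrable_def
        by (rule integrable_mult_indicator[rotated]) simp
      have i': "set_integrable lborel (- {- real n..real n}) (?f c)"
        using integrable_gauss_exp[OF c, of l] unfolding set_integrable_def
        by (rule integrable_mult_indicator[rotated]) simp
      have "?G n c = (LINT x:{- real n..real n}|lborel. ?f c x)"
        using set_borel_integral_eq_integral(2)[OF i] by simp
      moreover have "(\<integral>x. ?f c x \<partial>lborel) = (LINT x:{- real n..real n}|lborel. ?f c x)
         + (LINT x:- {- real n..real n}|lborel. ?f c x)"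
        using set_integral_Un[OF _ i i'] by (simp add: set_lebesgue_integral_def)
      ultimately have "dist (?G n c) (\<integral>x. ?f c x \<partial>lborel) = norm (LINT x:- {- real n..real n}|lborel. ?f c x)"
        by (simp add: dist_norm)
      also have "\<dots> \<le> T n"
        unfolding T_def set_lebesgue_integral_def
      proof (rule Bochner_Integration.integral_norm_bound_integral)
        show "integrable lborel (\<lambda>x. indicator (- {- real n..real n}) x *\<^sub>R ?f c x)"
          using i' by (simp add: set_integrable_def)
        show "integrable lborel (\<lambda>x. indicator (- {- real n..real n}) x * exp (- \<alpha> * x\<^sup>2))"
          using integrable_mult_indicator[OF _ integrable_exp_neg_square(1)[OF \<alpha>], of "- {- real n..real n}"]
          by simp
        show "norm (indicator (- {- real n..real n}) x *\<^sub>R ?f c x)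
            \<le> indicator (- {- real n..real n}) x * exp (- \<alpha> * x\<^sup>2)" for x
          unfolding norm_scaleR norm_exp_gauss using that
          by (auto simp: indicator_def mult_right_mono)
      qed
      finally show ?thesis .
    qed
    have "cball b \<alpha> \<subseteq> {c. Re c \<ge> \<alpha>}"
    proof
      fix c assume "c \<in> cball b \<alpha>"
      then have "\<bar>Re (b - c)\<bar> \<le> \<alpha>" using abs_Re_le_cmod[of "b - c"] by (simp add: dist_norm)
      then show "c \<in> {c. Re c \<ge> \<alpha>}" unfolding \<alpha>_def mem_Collect_eq minus_complex.sel by linarith
    qed
    moreover have "uniform_limit {c. Re c \<ge> \<alpha>} ?G (\<lambda>b. \<integral>x. ?f b x \<partial>lborel) sequentially"
      unfolding uniform_limit_iff
    proof (intro allI impI)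
      fix e :: real assume "e > 0"
      then have "\<forall>\<^sub>F n in sequentially. T n < e" using order_tendstoD(2)[OF T0] by blast
      then show "\<forall>\<^sub>F n in sequentially. \<forall>c\<in>{c. Re c \<ge> \<alpha>}. dist (?G n c) (\<integral>x. ?f c x \<partial>lborel) < e"
      proof (rule eventually_mono, intro ballI)
        fix n c assume n: "T n < e" and "c \<in> {c. Re c \<ge> \<alpha>}"
        then have "Re c \<ge> \<alpha>" by (simp only: mem_Collect_eq)
        from bound[OF this] n show "dist (?G n c) (\<integral>x. ?f c x \<partial>lborel) < e" by (rule le_less_trans)
      qed
    qed
    ultimately have "uniform_limit (cball b \<alpha>) ?G (\<lambda>b. \<integral>x. ?f b x \<partial>lborel) sequentially"
      by (rule uniform_limit_on_subset[rotated])
    moreover have "cball b \<alpha> \<subseteq> ?U"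
      using \<open>cball b \<alpha> \<subseteq> {c. Re c \<ge> \<alpha>}\<close> \<alpha> by fastforce
    ultimately show "\<exists>d>0. cball b d \<subseteq> ?U \<and> uniform_limit (cball b d) ?G (\<lambda>b. \<integral>x. ?f b x \<partial>lborel) sequentially"
      using \<alpha> by blast
  qed
qed

text \<open>Both sides are holomorphic on the right half-plane, which the branch cut of the
  principal root does not meet, and they agree on the positive axis; the identity theorem does the
  rest.\<close>

lemma integral_gauss_exp:
  assumes "Re b > 0"
  shows "csqrt b * (\<integral>x. exp (\<i> * of_real (l * x) - b * of_real x ^ 2) \<partial>lborel)
     = of_real (sqrt pi) * exp (- of_real (l\<^sup>2) / (4 * b))"
proof -
  let ?h = "\<lambda>b. csqrt b * (\<integral>x. exp (\<i> * of_real (l * x) - b * of_real x ^ 2) \<partial>lborel)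
       - of_real (sqrt pi) * exp (- of_real (l\<^sup>2) / (4 * b))"
  have "?h b = 0"
  proof (rule analytic_continuation[where f = ?h and S = "{b. Re b > 0}" and U = "complex_of_real ` {0<..}" and \<xi> = 1])
    show "?h holomorphic_on {b. Re b > 0}"
      by (intro holomorphic_intros holomorphic_gauss_exp) (auto simp: complex_nonpos_Reals_iff)
    show "open {b. Re b > 0}" by (simp add: open_halfspace_Re_gt)
    show "connected {b. Re b > 0}" by (simp add: convex_connected convex_halfspace_Re_gt)
    show "1 islimpt complex_of_real ` {0<..}"
      unfolding islimpt_sequential
    proof (intro exI[of _ "\<lambda>n. complex_of_real (1 + inverse (real (Suc n)))"] conjI allI)
      have "(\<lambda>n. complex_of_real (1 + inverse (real (Suc n)))) \<longlonglongrightarrow> complex_of_real (1 + 0)"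
        by (intro tendsto_intros LIMSEQ_inverse_real_of_nat)
      then show "(\<lambda>n. complex_of_real (1 + inverse (real (Suc n)))) \<longlonglongrightarrow> 1" by simp
      show "complex_of_real (1 + inverse (real (Suc n))) \<in> complex_of_real ` {0<..} - {1}" for n
        by (auto intro!: imageI add_pos_pos simp del: of_real_add)
    qed
    show "?h z = 0" if z: "z \<in> complex_of_real ` {0<..}" for z
    proof -
      obtain \<beta> where \<beta>: "\<beta> > 0" "z = of_real \<beta>" using z by auto
      have "csqrt z = of_real (sqrt \<beta>)" using \<beta> by simp
      then show ?thesis using \<beta> integral_gauss_exp_real[of \<beta> l]
        by (simp add: real_sqrt_divide flip: exp_of_real)
    qed
  qed (use assms in auto)
  then show ?thesis by simp
qed

section \<open>Moments of a weight\<close>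

locale moment_weight =
  fixes W :: "nat \<Rightarrow> ennreal"
  assumes weight: "is_weight W" and nontrivial: "\<exists>n\<ge>1. W n < \<infinity>"
begin

lemma ennreal_recip: "ennreal (recip W n) = inverse (W n)"
proof -
  have "W n \<noteq> 0" using weight unfolding is_weight_def by (metis not_one_le_zero)
  then have "inverse (W n) < top" by (simp add: less_top[symmetric])
  then show ?thesis unfolding recip_def by (rule ennreal_enn2real)
qed

lemma recip_nonneg [simp]: "recip W n \<ge> 0"
  by (simp add: recip_def)

lemma recip_sums: "recip W sums 1"
proof -
  have s: "(\<Sum>n. ennreal (recip W n)) = 1"
    using weight by (simp add: ennreal_recip is_weight_def)
  then have "summable (recip W)"
    by (intro summable_suminf_not_top) auto
  moreover from this s have "ennreal (suminf (recip W)) = ennreal 1"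
    by (simp add: suminf_ennreal2)
  then have "suminf (recip W) = 1"
    by (subst (asm) ennreal_inj) (auto intro: suminf_nonneg calculation)
  ultimately show ?thesis by (simp add: sums_iff)
qed

lemma summable_moment: "summable (\<lambda>n. sqrt (real n) ^ k * recip W n)"
proof -
  \<comment> \<open>With the crude bound n^(k/2) <= n^k, the decay exponent k + 2 leaves a majorant
    n^(-2).\<close>
  have "real k + 2 > 0" by simp
  then have "recip W \<in> O(\<lambda>n. real n powr - (real k + 2))"
    using weight unfolding is_weight_def by blast
  then obtain C where C: "eventually (\<lambda>n. norm (recip W n) \<le> C * norm (real n powr - (real k + 2))) at_top"
    by (rule landau_o.bigE)
  show ?thesis
  proof (rule summable_comparison_test_ev)
    show "summable (\<lambda>n. C * (real n powr - 2))"
      by (intro summable_mult) (simp add: summable_real_powr_iff)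
    show "eventually (\<lambda>n. norm (sqrt (real n) ^ k * recip W n) \<le> C * (real n powr - 2)) sequentially"
      using C eventually_ge_at_top[of 1]
    proof eventually_elim
      fix n :: nat assume n: "norm (recip W n) \<le> C * norm (real n powr - (real k + 2))" "1 \<le> n"
      have "sqrt (real n) \<le> real n" using n by (intro real_le_lsqrt self_le_power) auto
      then have "sqrt (real n) ^ k \<le> real n powr real k"
        using n by (simp add: powr_realpow power_mono)
      then have "sqrt (real n) ^ k * recip W n \<le> real n powr real k * (C * real n powr - (real k + 2))"
        using n by (intro mult_mono) auto
      also have "\<dots> = C * (real n powr real k * real n powr - (real k + 2))" by simp
      also have "real n powr real k * real n powr - (real k + 2) = real n powr - 2"
        by (simp flip: powr_add)
      finally show "norm (sqrt (real n) ^ k * recip W n) \<le> C * (real n powr - 2)" by simp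
    qed
  qed
qed

lemma moment_0: "moment W 0 = 1"
  using recip_sums by (simp add: moment_def sums_iff)

lemma recip_pos: "\<exists>n\<ge>1. recip W n > 0"
proof -
  obtain n where n: "n \<ge> 1" "W n < \<infinity>" using nontrivial by blast
  then have "ennreal (recip W n) \<noteq> 0" unfolding ennreal_recip by (simp add: ennreal_inverse_eq_0_iff)
  then have "recip W n \<noteq> 0" by auto
  then have "recip W n > 0" using recip_nonneg[of n] by linarith
  then show ?thesis using n by blast
qed

lemma moment_ge: "sqrt (real n) ^ k * recip W n \<le> moment W k"
  unfolding moment_def
  using sum_le_suminf[OF summable_moment, of "{n}" k] by simp

lemma moment_pos: "moment W k > 0"
proof -
  obtain n where "n \<ge> 1" "recip W n > 0" using recip_pos by blast
  then have "0 < sqrt (real n) ^ k * recip W n" by simp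
  also have "\<dots> \<le> moment W k" by (rule moment_ge)
  finally show ?thesis .
qed

lemma hfun_pos: "hfun W k > 0"
  by (simp add: hfun_def moment_pos)

text \<open>The quadratic \<open>\<lambda> \<mapsto> \<Sum> n\<^bsup>k/2\<^esup> (n\<^bsup>1/2\<^esup> - \<lambda>)\<^sup>2 / w\<^sub>n\<close> is nonnegative.\<close>

lemma moment_log_convex: "(moment W (Suc k))\<^sup>2 \<le> moment W k * moment W (Suc (Suc k))"
proof -
  define l where "l = moment W (Suc k) / moment W k"
  have s: "(\<lambda>n. sqrt (real n) ^ j * recip W n) sums moment W j" for j
    unfolding moment_def using summable_moment by (rule summable_sums)
  have "(\<lambda>n. sqrt (real n) ^ Suc (Suc k) * recip W n - 2 * l * (sqrt (real n) ^ Suc k * recip W n)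
      + l\<^sup>2 * (sqrt (real n) ^ k * recip W n)) sums
     (moment W (Suc (Suc k)) - 2 * l * moment W (Suc k) + l\<^sup>2 * moment W k)"
    by (intro sums_add sums_diff sums_mult s)
  moreover have "sqrt (real n) ^ Suc (Suc k) * recip W n - 2 * l * (sqrt (real n) ^ Suc k * recip W n)
      + l\<^sup>2 * (sqrt (real n) ^ k * recip W n) = sqrt (real n) ^ k * (sqrt (real n) - l)\<^sup>2 * recip W n" for n
    by (simp add: power2_eq_square algebra_simps)
  ultimately have S: "(\<lambda>n. sqrt (real n) ^ k * (sqrt (real n) - l)\<^sup>2 * recip W n) sums
     (moment W (Suc (Suc k)) - 2 * l * moment W (Suc k) + l\<^sup>2 * moment W k)"
    by (simp only:)
  have "0 \<le> moment W (Suc (Suc k)) - 2 * l * moment W (Suc k) + l\<^sup>2 * moment W k"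
    by (rule sums_le[OF _ sums_zero S]) simp
  also have "\<dots> = moment W (Suc (Suc k)) - (moment W (Suc k))\<^sup>2 / moment W k"
    using moment_pos[of k] by (simp add: l_def power2_eq_square field_simps)
  finally show ?thesis using moment_pos[of k] by (simp add: field_simps)
qed

lemma hfun_Suc_le: "k \<ge> 1 \<Longrightarrow> hfun W (Suc k) \<le> hfun W k"
  using moment_log_convex[of "k - 1"] moment_pos[of k] moment_pos[of "Suc k"]
  by (simp add: hfun_def divide_simps power2_eq_square mult_ac)

lemma hfun_antimono:
  assumes "1 \<le> k" "k \<le> l" shows "hfun W l \<le> hfun W k"
  using assms(2)
proof (induction rule: dec_induct)
  case (step n)
  then show ?case using hfun_Suc_le[of n] assms(1) by linarith
qed simp

text \<open>The quotient of the moments of orders k and k + i is the product h(k+1) ... h(k+i),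
  whose last factor is the smallest. Through this estimate, i orders of differentiation are traded
  for h^i.\<close>

lemma moment_add_le:
  assumes "0 \<le> h" "h \<le> hfun W (k + i)"
  shows "h ^ i * moment W (k + i) \<le> moment W k"
  using assms(2)
proof (induction i)
  case (Suc i)
  \<comment> \<open>\<open>hfun W 0\<close> is the default value 1 and lies outside the range of
    monotonicity; for k + i = 0 the claim is trivial.\<close>
  have "h \<le> hfun W (k + i)" if "k + i \<ge> 1"
    using Suc.prems hfun_Suc_le[OF that] by simp
  then have IH: "h ^ i * moment W (k + i) \<le> moment W k"
    using Suc.IH by (cases "k + i = 0") auto
  have "h * moment W (Suc (k + i)) \<le> moment W (k + i)"
    using Suc.prems moment_pos[of "Suc (k + i)"] by (simp add: hfun_def field_simps)
  then have "h ^ i * (h * moment W (Suc (k + i))) \<le> h ^ i * moment W (k + i)"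
    using assms(1) by (intro mult_left_mono) auto
  with IH show ?case by (simp add: mult_ac)
qed simp

end

section \<open>Bang's propagation of flatness\<close>

text \<open>The k-th derivative of the cosine. The exponential form treats all four residues of k
  modulo 4 at once and reduces the Taylor remainder to that of \<open>iexp\<close>.\<close>

definition cos_deriv :: "nat \<Rightarrow> real \<Rightarrow> complex" where
  "cos_deriv k y = (\<i> ^ k * iexp y + (-\<i>) ^ k * iexp (- y)) / 2"

lemma norm_cos_deriv_le: "norm (cos_deriv k y) \<le> 1"
proof -
  have "norm (\<i> ^ k * iexp y + (-\<i>) ^ k * iexp (- y)) \<le> norm (\<i> ^ k * iexp y) + norm ((-\<i>) ^ k * iexp (- y))"
    by (rule norm_triangle_ineq)
  also have "\<dots> = 2" unfolding norm_mult norm_power by (simp only: norm_exp_i_times norm_minus_cancel norm_ii power_one)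
  finally show ?thesis by (simp add: cos_deriv_def norm_divide)
qed

lemma cos_deriv_0_odd: "odd k \<Longrightarrow> cos_deriv k 0 = 0"
  by (simp add: cos_deriv_def power_minus_odd)

lemma cos_deriv_0_even: "cos_deriv (2 * j) 0 = (-1) ^ j"
  by (simp add: cos_deriv_def power_mult)

text \<open>The remainder is the mean of the remainders of \<open>iexp\<close> at t and at -t, each
  with a factor of modulus 1.\<close>

lemma cos_deriv_taylor:
  "norm (cos_deriv k (y + t) - (\<Sum>i\<le>m. of_real (t ^ i / fact i) * cos_deriv (k + i) y))
     \<le> \<bar>t\<bar> ^ Suc m / fact (Suc m)"
proof -
  define P where "P z = iexp z - (\<Sum>i\<le>m. (\<i> * of_real z) ^ i / fact i)" for z :: real
  have P: "norm (P z) \<le> \<bar>z\<bar> ^ Suc m / fact (Suc m)" for z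
    unfolding P_def by (rule iexp_approx1)
  have "cos_deriv k (y + t) - (\<Sum>i\<le>m. of_real (t ^ i / fact i) * cos_deriv (k + i) y)
      = (\<i> ^ k * iexp y * P t + (-\<i>) ^ k * iexp (- y) * P (- t)) / 2"
  proof -
    have 1: "iexp (y + t) = iexp y * iexp t" "iexp (- (y + t)) = iexp (- y) * iexp (- t)"
      by (simp_all add: exp_add[symmetric] algebra_simps)
    have 2: "of_real (t ^ i / fact i) * cos_deriv (k + i) y
       = (\<i> ^ k * iexp y * ((\<i> * of_real t) ^ i / fact i) + (-\<i>) ^ k * iexp (- y) * ((\<i> * of_real (- t)) ^ i / fact i)) / 2" for i
    proof -
      have "(\<i> * of_real (- t)) ^ i = (-\<i>) ^ i * of_real t ^ i"
        by (simp flip: power_mult_distrib)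
      then show ?thesis
        by (simp add: cos_deriv_def power_add power_mult_distrib add_divide_distrib distrib_left mult_ac)
    qed
    have 3: "(\<Sum>i\<le>m. (p * f i + q * g i) / 2) = (p * (\<Sum>i\<le>m. f i) + q * (\<Sum>i\<le>m. g i)) / 2"
      for p q :: complex and f g
      by (simp only: sum_divide_distrib[symmetric] sum.distrib sum_distrib_left)
    show ?thesis
      unfolding 2 3 unfolding cos_deriv_def 1 P_def by (simp only: diff_divide_distrib add_divide_distrib right_diff_distrib mult.assoc) simp
  qed
  also have "norm \<dots> \<le> (norm (P t) + norm (P (- t))) / 2"
  proof -
    have "norm (\<i> ^ k * iexp y * P t + (-\<i>) ^ k * iexp (- y) * P (- t))
       \<le> norm (\<i> ^ k * iexp y * P t) + norm ((-\<i>) ^ k * iexp (- y) * P (- t))"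
      by (rule norm_triangle_ineq)
    also have "\<dots> = norm (P t) + norm (P (- t))"
      unfolding norm_mult norm_power by (simp only: norm_exp_i_times norm_minus_cancel norm_ii power_one mult_1)
    finally show ?thesis by (simp add: norm_divide)
  qed
  also have "\<dots> \<le> \<bar>t\<bar> ^ Suc m / fact (Suc m)"
  proof -
    have "(a + b) / 2 \<le> X" if "a \<le> X" "b \<le> X" for a b X :: real using that by simp
    then show ?thesis using P[of t] P[of "- t"] unfolding abs_minus_cancel by blast
  qed
  finally show ?thesis .
qed

context moment_weight
begin

text \<open>
  For \<open>c\<^sub>n = a\<^sub>n e\<^bsup>in\<theta>\<^esup>\<close> this is the \<open>k\<close>-th derivative of \<open>\<Sum>c\<^sub>n cos (n\<^bsup>1/2\<^esup> x)\<close>.  It satisfies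
  Denjoy--Carleman bounds with the half-integer moments, and its even derivatives at \<open>0\<close> are the
  angular derivatives of \<open>f\<close> at the boundary point \<open>e\<^bsup>i\<theta>\<^esup>\<close>.
\<close>

definition cos_series :: "(nat \<Rightarrow> complex) \<Rightarrow> nat \<Rightarrow> real \<Rightarrow> complex" where
  "cos_series c k x = (\<Sum>n. c n * of_real (sqrt (real n) ^ k) * cos_deriv k (sqrt (real n) * x))"

context
  fixes c :: "nat \<Rightarrow> complex"
  assumes c: "\<And>n. norm (c n) \<le> recip W n"
begin

lemma norm_cos_series_term:
  "norm (c n * of_real (sqrt (real n) ^ k) * cos_deriv j y) \<le> sqrt (real n) ^ k * recip W n"
proof -
  have "norm (c n * of_real (sqrt (real n) ^ k) * cos_deriv j y)
     = norm (c n) * sqrt (real n) ^ k * norm (cos_deriv j y)"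
    by (simp add: norm_mult norm_power)
  also have "\<dots> \<le> recip W n * sqrt (real n) ^ k * 1"
    by (intro mult_mono c norm_cos_deriv_le) (auto intro!: mult_nonneg_nonneg)
  finally show ?thesis by (simp add: mult_ac)
qed

lemma cos_series_sums:
  "(\<lambda>n. c n * of_real (sqrt (real n) ^ k) * cos_deriv k (sqrt (real n) * x)) sums cos_series c k x"
  unfolding cos_series_def
  by (intro summable_sums summable_comparison_test'[OF summable_moment[of k]] norm_cos_series_term)

lemma norm_cos_series_le: "norm (cos_series c k x) \<le> moment W k"
  unfolding moment_def
  by (intro norm_sums_le[OF cos_series_sums summable_sums[OF summable_moment] norm_cos_series_term])

text \<open>The Taylor formula is applied to each cosine and then summed, so the series itself never
  has to be differentiated; the power of sqrt n in the remainder produces the higher moment.\<close>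

lemma cos_series_taylor:
  "norm (cos_series c k (x + s) - (\<Sum>i\<le>m. of_real (s ^ i / fact i) * cos_series c (k + i) x))
     \<le> \<bar>s\<bar> ^ Suc m / fact (Suc m) * moment W (k + Suc m)"
proof (rule norm_sums_le)
  show "(\<lambda>n. c n * of_real (sqrt (real n) ^ k) * cos_deriv k (sqrt (real n) * (x + s))
     - (\<Sum>i\<le>m. of_real (s ^ i / fact i) * (c n * of_real (sqrt (real n) ^ (k + i)) * cos_deriv (k + i) (sqrt (real n) * x))))
     sums (cos_series c k (x + s) - (\<Sum>i\<le>m. of_real (s ^ i / fact i) * cos_series c (k + i) x))"
    by (intro sums_diff sums_sum sums_mult cos_series_sums)
  show "(\<lambda>n. \<bar>s\<bar> ^ Suc m / fact (Suc m) * (sqrt (real n) ^ (k + Suc m) * recip W n)) sums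
      (\<bar>s\<bar> ^ Suc m / fact (Suc m) * moment W (k + Suc m))"
    unfolding moment_def by (intro sums_mult summable_sums summable_moment)
  fix n
  let ?l = "sqrt (real n)"
  let ?D = "cos_deriv k (?l * x + ?l * s) - (\<Sum>i\<le>m. of_real ((?l * s) ^ i / fact i) * cos_deriv (k + i) (?l * x))"
  have "c n * of_real (?l ^ k) * cos_deriv k (?l * (x + s))
     - (\<Sum>i\<le>m. of_real (s ^ i / fact i) * (c n * of_real (?l ^ (k + i)) * cos_deriv (k + i) (?l * x)))
     = c n * of_real (?l ^ k) * ?D"
    unfolding right_diff_distrib sum_distrib_left distrib_left
    by (intro arg_cong2[of _ _ _ _ "(-)"] sum.cong refl) (simp_all add: power_add power_mult_distrib mult_ac)
  also have "norm \<dots> = norm (c n) * ?l ^ k * norm ?D"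
    by (simp add: norm_mult norm_power)
  also have "\<dots> \<le> recip W n * ?l ^ k * (\<bar>?l * s\<bar> ^ Suc m / fact (Suc m))"
    by (intro mult_mono c cos_deriv_taylor) (auto intro!: mult_nonneg_nonneg)
  also have "\<dots> = \<bar>s\<bar> ^ Suc m / fact (Suc m) * (?l ^ (k + Suc m) * recip W n)"
    by (simp add: abs_mult power_mult_distrib power_add mult_ac)
  finally show "norm (c n * of_real (?l ^ k) * cos_deriv k (?l * (x + s))
     - (\<Sum>i\<le>m. of_real (s ^ i / fact i) * (c n * of_real (?l ^ (k + i)) * cos_deriv (k + i) (?l * x))))
     \<le> \<bar>s\<bar> ^ Suc m / fact (Suc m) * (?l ^ (k + Suc m) * recip W n)" .
qed

text \<open>
  Since \<open>\<bar>F\<^bsup>(k)\<^esup>\<bar> \<le> M\<^sub>k\<close> always holds, level \<open>q\<close> constrains only the derivatives of order below \<open>q\<close>;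
  a step of length \<open>h(q)/e\<close> costs one level.
\<close>

definition bang_flat :: "nat \<Rightarrow> real \<Rightarrow> bool" where
  "bang_flat q x \<longleftrightarrow> (\<forall>k\<le>q. norm (cos_series c k x) \<le> exp (real k - real q) * moment W k)"

text \<open>In the Taylor expansion at x, passing from order k to k + i loses a factor e^i in the
  flatness, which |s| <= h/e makes up for. So the i-th term is at most E / i!, the terms sum to at
  most E e, and the factor e is exactly one level.\<close>

lemma bang_flat_step:
  assumes flat: "bang_flat (Suc q) x" and s: "exp 1 * \<bar>s\<bar> \<le> hfun W (Suc q)"
  shows "bang_flat q (x + s)"
  unfolding bang_flat_def
proof (intro allI impI)
  fix k assume k: "k \<le> q"
  \<comment> \<open>With this length the remainder has order \<open>k + Suc m = Suc q\<close>, where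
    the flatness bound coincides with the universal bound \<open>moment W (Suc q)\<close>.\<close>
  define m where "m = q - k"
  define h where "h = hfun W (Suc q)"
  have h: "h > 0" by (simp add: h_def hfun_pos)
  define E where "E = exp (real k - real (Suc q)) * moment W k"
  have E: "E \<ge> 0" using moment_pos[of k] by (simp add: E_def)
  have key: "\<bar>s\<bar> ^ i / fact i * (exp (real (k + i) - real (Suc q)) * moment W (k + i)) \<le> E * (1 / fact i)"
    if i: "i \<le> Suc m" for i
  proof -
    have "h \<le> hfun W (k + i)" if "k + i \<ge> 1"
      using that i k unfolding h_def m_def by (intro hfun_antimono) auto
    then have M: "h ^ i * moment W (k + i) \<le> moment W k"
      using h moment_add_le[of h k i] by (cases "k + i = 0") auto
    have "(exp 1 * \<bar>s\<bar>) ^ i \<le> h ^ i" using s by (intro power_mono) (auto simp: h_def)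
    then have "(exp 1 * \<bar>s\<bar>) ^ i * moment W (k + i) \<le> h ^ i * moment W (k + i)"
      using moment_pos[of "k + i"] by (intro mult_right_mono) auto
    with M have *: "(exp 1 * \<bar>s\<bar>) ^ i * moment W (k + i) \<le> moment W k" by linarith
    have e: "exp (real (k + i) - real (Suc q)) = exp 1 ^ i * exp (real k - real (Suc q))"
      by (simp add: exp_of_nat_mult[symmetric] exp_add[symmetric] algebra_simps)
    have "\<bar>s\<bar> ^ i / fact i * (exp (real (k + i) - real (Suc q)) * moment W (k + i))
       = exp (real k - real (Suc q)) / fact i * ((exp 1 * \<bar>s\<bar>) ^ i * moment W (k + i))"
      unfolding e by (simp add: power_mult_distrib)
    also have "\<dots> \<le> exp (real k - real (Suc q)) / fact i * moment W k"
      by (intro mult_left_mono *) auto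
    finally show ?thesis by (simp add: E_def)
  qed
  have "norm (cos_series c k (x + s)) \<le> norm (\<Sum>i\<le>m. of_real (s ^ i / fact i) * cos_series c (k + i) x)
     + norm (cos_series c k (x + s) - (\<Sum>i\<le>m. of_real (s ^ i / fact i) * cos_series c (k + i) x))"
    by (rule norm_triangle_sub)
  also have "\<dots> \<le> (\<Sum>i\<le>m. E * (1 / fact i)) + E * (1 / fact (Suc m))"
  proof (rule add_mono)
    show "norm (\<Sum>i\<le>m. of_real (s ^ i / fact i) * cos_series c (k + i) x) \<le> (\<Sum>i\<le>m. E * (1 / fact i))"
    proof (rule sum_norm_le)
      fix i assume i: "i \<in> {..m}"
      have "norm (of_real (s ^ i / fact i) * cos_series c (k + i) x) = \<bar>s\<bar> ^ i / fact i * norm (cos_series c (k + i) x)"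
        by (simp add: norm_mult norm_divide norm_power)
      also have "\<dots> \<le> \<bar>s\<bar> ^ i / fact i * (exp (real (k + i) - real (Suc q)) * moment W (k + i))"
        using flat[unfolded bang_flat_def, rule_format, of "k + i"] i k unfolding m_def
        by (intro mult_left_mono) auto
      also have "\<dots> \<le> E * (1 / fact i)" using i by (intro key) simp
      finally show "norm (of_real (s ^ i / fact i) * cos_series c (k + i) x) \<le> E * (1 / fact i)" .
    qed
    have "k + Suc m = Suc q" using k by (simp add: m_def)
    then show "norm (cos_series c k (x + s) - (\<Sum>i\<le>m. of_real (s ^ i / fact i) * cos_series c (k + i) x)) \<le> E * (1 / fact (Suc m))"
      using cos_series_taylor[of k x s m] key[of "Suc m"] by simp
  qed
  also have "\<dots> = E * (\<Sum>i\<le>Suc m. 1 / fact i)"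
    by (simp add: sum_distrib_left distrib_left)
  also have "(\<Sum>i\<le>Suc m. 1 / fact i) \<le> exp (1::real)"
    unfolding exp_def using summable_exp[of "1::real"]
    by (simp add: divide_inverse del: sum.atMost_Suc) (rule sum_le_suminf, auto)
  then have "E * (\<Sum>i\<le>Suc m. 1 / fact i) \<le> E * exp 1" using E by (intro mult_left_mono) auto
  also have "E * exp 1 = exp (real k - real q) * moment W k"
  proof -
    have "exp (real k - real (Suc q)) * exp 1 = exp (real k - real q)"
      by (subst exp_add[symmetric]) simp
    then show ?thesis by (simp add: E_def mult_ac)
  qed
  finally show "norm (cos_series c k (x + s)) \<le> exp (real k - real q) * moment W k" .
qed

text \<open>The levels p, ..., N + 1 are spent one at a time, on steps of length at most h(p)/e,
  ..., h(N+1)/e. Their total is (H(p) - H(N))/e.\<close>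

lemma bang_flat_propagate:
  assumes "N \<le> p" "bang_flat p x" "exp 1 * \<bar>y - x\<bar> \<le> Hfun W p - Hfun W N"
  shows "bang_flat N y"
  using assms
proof (induction p arbitrary: x rule: dec_induct)
  case base
  then have "exp 1 * \<bar>y - x\<bar> \<le> 0" by simp
  then have "y = x" by (simp add: mult_le_0_iff)
  with base show ?case by simp
next
  case (step p)
  define d where "d = hfun W (Suc p) / exp 1"
  have d: "d > 0" "exp 1 * d = hfun W (Suc p)" by (simp_all add: d_def hfun_pos)
  \<comment> \<open>The longest admissible step towards y, clamped so that it does not
    overshoot.\<close>
  define s where "s = max (- d) (min d (y - x))"
  have "\<bar>s\<bar> \<le> d" using d by (auto simp: s_def)
  then have "exp 1 * \<bar>s\<bar> \<le> exp 1 * d" by simp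
  then have flat: "bang_flat p (x + s)"
    using step.prems(1) d by (intro bang_flat_step) auto
  have H: "Hfun W (Suc p) = Hfun W p + exp 1 * d" by (simp add: Hfun_def d)
  have mono: "Hfun W N \<le> Hfun W p"
    unfolding Hfun_def using step.hyps hfun_pos by (intro sum_mono2) (auto intro: less_imp_le)
  have "\<bar>y - (x + s)\<bar> = max 0 (\<bar>y - x\<bar> - d)" using d by (auto simp: s_def)
  then have "exp 1 * \<bar>y - (x + s)\<bar> = max 0 (exp 1 * \<bar>y - x\<bar> - exp 1 * d)"
    by (simp add: max_def right_diff_distrib)
  also have "\<dots> \<le> Hfun W p - Hfun W N" using step.prems(2) H mono by simp
  finally show ?case by (rule step.IH[OF flat])
qed

text \<open>Order p itself needs no hypothesis: there the required bound is the universal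
  one.\<close>

lemma bang_flatI: "(\<And>k. k < p \<Longrightarrow> norm (cos_series c k x) \<le> exp (real k - real p) * moment W k) \<Longrightarrow> bang_flat p x"
  unfolding bang_flat_def using norm_cos_series_le[of p x] by (auto simp: le_less)

lemma norm_cos_series_le_exp:
  assumes "\<And>k. k < p \<Longrightarrow> norm (cos_series c k 0) \<le> exp (real k - real p) * moment W k"
    and "N \<le> p" "exp 1 * \<bar>y\<bar> \<le> Hfun W p - Hfun W N"
  shows "norm (cos_series c 0 y) \<le> exp (- real N)"
  using bang_flat_propagate[OF assms(2) bang_flatI[OF assms(1)], of y, unfolded bang_flat_def, rule_format, of 0]
    assms(3)
  by (simp add: moment_0)

end
end

section \<open>Gaussian averages\<close>

context moment_weight
begin

lemma rapid_if_le_recip: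
  assumes "\<And>n. norm (c n) \<le> recip W n"
  shows "rapid c"
  unfolding rapid_def
proof
  fix k
  show "summable (\<lambda>n. real (n choose k) * norm (c n))"
  proof (rule summable_comparison_test'[OF summable_moment[of "2 * k"]])
    fix n
    have "n choose k \<le> n ^ k"
      using binomial_le_pow[of k n] by (cases "k \<le> n") (auto simp: binomial_eq_0)
    then have "real (n choose k) \<le> real n ^ k" by (simp flip: of_nat_power)
    then show "norm (real (n choose k) * norm (c n)) \<le> sqrt (real n) ^ (2 * k) * recip W n"
      using assms[of n] by (simp add: power_mult mult_mono)
  qed
qed

context
  fixes c :: "nat \<Rightarrow> complex"
  assumes c: "\<And>n. norm (c n) \<le> recip W n"
begin

lemma summable_norm_coeffs: "summable (\<lambda>n. norm (c n))"
  by (rule summable_comparison_test'[OF sums_summable[OF recip_sums]]) (simp add: c)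

lemma integral_cos_deriv_gauss:
  assumes "Re b > 0"
  shows "integrable lborel (\<lambda>x. cos_deriv 0 (l * x) * exp (- b * of_real x ^ 2))"
    and "csqrt b * (\<integral>x. cos_deriv 0 (l * x) * exp (- b * of_real x ^ 2) \<partial>lborel)
       = of_real (sqrt pi) * exp (- of_real (l\<^sup>2) / (4 * b))"
proof -
  let ?e = "\<lambda>l x. exp (\<i> * of_real (l * x) - b * of_real x ^ 2)"
  have eq: "(\<lambda>x. cos_deriv 0 (l * x) * exp (- b * of_real x ^ 2)) = (\<lambda>x. (?e l x + ?e (- l) x) / 2)"
    by (rule ext) (simp add: cos_deriv_def exp_diff exp_minus field_simps)
  have i: "integrable lborel (?e l)" for l by (rule integrable_gauss_exp[OF assms])
  show "integrable lborel (\<lambda>x. cos_deriv 0 (l * x) * exp (- b * of_real x ^ 2))"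
    unfolding eq by (intro integrable_divide_zero Bochner_Integration.integrable_add i)
  have "(\<integral>x. (?e l x + ?e (- l) x) / 2 \<partial>lborel) = ((\<integral>x. ?e l x \<partial>lborel) + (\<integral>x. ?e (- l) x \<partial>lborel)) / 2"
    by (subst integral_divide_zero, subst Bochner_Integration.integral_add[OF i i]) (rule refl)
  then have "csqrt b * (\<integral>x. (?e l x + ?e (- l) x) / 2 \<partial>lborel)
     = (csqrt b * (\<integral>x. ?e l x \<partial>lborel) + csqrt b * (\<integral>x. ?e (- l) x \<partial>lborel)) / 2"
    by (simp only: distrib_left times_divide_eq_right)
  then show "csqrt b * (\<integral>x. cos_deriv 0 (l * x) * exp (- b * of_real x ^ 2) \<partial>lborel)
       = of_real (sqrt pi) * exp (- of_real (l\<^sup>2) / (4 * b))"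
    unfolding eq integral_gauss_exp[OF assms] by simp
qed

text \<open>The Gaussian transform of cos (sqrt n x) is a multiple of exp (- n / (4 b)), so
  averaging F evaluates the power series at exp (- 1 / (4 b)). The L1 norms of the terms are
  summable, which permits the exchange of sum and integral.\<close>

lemma integral_cos_series_gauss:
  assumes "Re b > 0"
  shows "integrable lborel (\<lambda>x. cos_series c 0 x * exp (- b * of_real x ^ 2))"
    and "csqrt b * (\<integral>x. cos_series c 0 x * exp (- b * of_real x ^ 2) \<partial>lborel)
       = of_real (sqrt pi) * (\<Sum>n. c n * exp (- of_nat n / (4 * b)))"
proof -
  let ?g = "\<lambda>x. exp (- b * of_real x ^ 2)"
  let ?h = "\<lambda>n x. c n * (cos_deriv 0 (sqrt (real n) * x) * ?g x)"
  have norm_g: "norm (?g x) = exp (- Re b * x\<^sup>2)" for x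
    by (simp add: norm_exp_eq_Re flip: of_real_power)
  have bound: "norm (?h n x) \<le> recip W n * exp (- Re b * x\<^sup>2)" for n x
    unfolding norm_mult norm_g using mult_mono[OF c norm_cos_deriv_le] by (auto simp: mult_right_mono)
  have ih: "integrable lborel (?h n)" for n
    by (intro integrable_mult_right integral_cos_deriv_gauss(1)[OF assms])
  have ig: "integrable lborel (\<lambda>x. recip W n * exp (- Re b * x\<^sup>2))" for n
    by (intro integrable_mult_right integrable_exp_neg_square(1)[OF assms])
  have eq: "(\<lambda>x. cos_series c 0 x * ?g x) = (\<lambda>x. \<Sum>n. ?h n x)"
  proof
    fix x
    show "cos_series c 0 x * ?g x = (\<Sum>n. ?h n x)"
      using sums_mult2[OF cos_series_sums[OF c, of 0 x], of "?g x"] by (simp add: sums_iff mult.assoc)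
  qed
  have AE: "AE x in lborel. summable (\<lambda>n. norm (?h n x))"
  proof (rule AE_I2)
    fix x
    have "summable (\<lambda>n. recip W n * exp (- Re b * x\<^sup>2))"
      using sums_summable[OF recip_sums] by (rule summable_mult2)
    then show "summable (\<lambda>n. norm (?h n x))"
      by (rule summable_comparison_test') (use bound in auto)
  qed
  have sn: "summable (\<lambda>n. \<integral>x. norm (?h n x) \<partial>lborel)"
  proof (rule summable_comparison_test')
    show "summable (\<lambda>n. recip W n * sqrt (pi / Re b))"
      using sums_summable[OF recip_sums] by (rule summable_mult2)
    fix n
    have "(\<integral>x. norm (?h n x) \<partial>lborel) \<le> (\<integral>x. recip W n * exp (- Re b * x\<^sup>2) \<partial>lborel)"
      by (intro integral_mono integrable_norm ih ig bound)
    also have "\<dots> = recip W n * sqrt (pi / Re b)"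
      using integrable_exp_neg_square(2)[OF assms] by simp
    finally show "norm (\<integral>x. norm (?h n x) \<partial>lborel) \<le> recip W n * sqrt (pi / Re b)" by simp
  qed
  show "integrable lborel (\<lambda>x. cos_series c 0 x * ?g x)"
    unfolding eq by (rule integrable_suminf[OF ih AE sn])
  have sums: "(\<lambda>n. \<integral>x. ?h n x \<partial>lborel) sums (\<integral>x. cos_series c 0 x * ?g x \<partial>lborel)"
    unfolding eq by (rule sums_integral[OF ih AE sn])
  have val: "csqrt b * (\<integral>x. ?h n x \<partial>lborel) = of_real (sqrt pi) * (c n * exp (- of_nat n / (4 * b)))" for n
  proof -
    have "csqrt b * (\<integral>x. ?h n x \<partial>lborel) = c n * (csqrt b * (\<integral>x. cos_deriv 0 (sqrt (real n) * x) * ?g x \<partial>lborel))"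
      by simp
    also have "\<dots> = of_real (sqrt pi) * (c n * exp (- of_nat n / (4 * b)))"
      unfolding integral_cos_deriv_gauss(2)[OF assms] by simp
    finally show ?thesis .
  qed
  have "(\<lambda>n. of_real (sqrt pi) * (c n * exp (- of_nat n / (4 * b)))) sums (csqrt b * (\<integral>x. cos_series c 0 x * ?g x \<partial>lborel))"
    using sums_mult[OF sums, of "csqrt b"] unfolding val .
  moreover have "summable (\<lambda>n. c n * exp (- of_nat n / (4 * b)))"
  proof (rule summable_comparison_test'[OF summable_norm_coeffs])
    fix n
    have "Re (- of_nat n / (4 * b)) \<le> 0"
      using assms by (auto simp: Re_divide divide_nonneg_nonneg mult_nonneg_nonneg)
    then show "norm (c n * exp (- of_nat n / (4 * b))) \<le> norm (c n)"
      by (simp add: norm_mult mult_left_le)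
  qed
  then have "(\<lambda>n. of_real (sqrt pi) * (c n * exp (- of_nat n / (4 * b)))) sums
      (of_real (sqrt pi) * (\<Sum>n. c n * exp (- of_nat n / (4 * b))))"
    by (intro sums_mult summable_sums)
  ultimately show "csqrt b * (\<integral>x. cos_series c 0 x * ?g x \<partial>lborel)
       = of_real (sqrt pi) * (\<Sum>n. c n * exp (- of_nat n / (4 * b)))"
    by (rule sums_unique2)
qed

text \<open>The integral is split at |x| = X. Outside, F is only known to be at most 1; three
  quarters of the Gaussian exponent become the constant \<delta> and the last quarter keeps the
  integral finite, at the price of a factor 2. The root of |t| / Re t measures how far the variance
  is from being real.\<close>

lemma norm_laplace_le:
  assumes t: "Re t > 0" and "\<epsilon> \<ge> 0"
    and small: "\<And>x. \<bar>x\<bar> \<le> X \<Longrightarrow> norm (cos_series c 0 x) \<le> \<epsilon>" and "X \<ge> 0"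
  shows "norm (\<Sum>n. c n * exp (- of_nat n * t))
     \<le> sqrt (norm t / Re t) * (\<epsilon> + 2 * exp (- (3 / 16 * Re t / (norm t)\<^sup>2 * X\<^sup>2)))"
proof -
  define b where "b = 1 / (4 * t)"
  define \<alpha> where "\<alpha> = Re b"
  have t0: "t \<noteq> 0" using t by auto
  have b4: "of_nat n / (4 * b) = of_nat n * t" for n using t0 by (simp add: b_def)
  have \<alpha>_eq: "\<alpha> = Re t / (4 * (norm t)\<^sup>2)"
  proof -
    have "b = inverse t / 4" by (simp add: b_def inverse_eq_divide)
    then have "Re b = Re (inverse t) / 4" by (simp only: Re_divide_numeral)
    then show ?thesis by (simp add: \<alpha>_def cmod_power2)
  qed
  have \<alpha>: "\<alpha> > 0" using t t0 by (simp add: \<alpha>_eq)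
  let ?g = "\<lambda>x. exp (- b * of_real x ^ 2)"
  define \<delta> where "\<delta> = exp (- (3 / 4 * \<alpha> * X\<^sup>2))"
  have norm_g: "norm (?g x) = exp (- \<alpha> * x\<^sup>2)" for x
    by (simp add: norm_exp_eq_Re \<alpha>_def flip: of_real_power)
  have bound: "norm (cos_series c 0 x * ?g x) \<le> \<epsilon> * exp (- \<alpha> * x\<^sup>2) + \<delta> * exp (- (\<alpha> / 4) * x\<^sup>2)" for x
  proof (cases "\<bar>x\<bar> \<le> X")
    case True
    then have "norm (cos_series c 0 x * ?g x) \<le> \<epsilon> * exp (- \<alpha> * x\<^sup>2)"
      unfolding norm_mult norm_g by (intro mult_right_mono small) auto
    then show ?thesis by (simp add: \<delta>_def add_increasing2)
  next
    case False
    then have "X\<^sup>2 \<le> x\<^sup>2" using \<open>X \<ge> 0\<close> by (metis abs_le_square_iff abs_of_nonneg linear)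
    then have "3 / 4 * \<alpha> * X\<^sup>2 \<le> 3 / 4 * \<alpha> * x\<^sup>2" using \<alpha> by simp
    then have "exp (- \<alpha> * x\<^sup>2) \<le> exp (- (3 / 4 * \<alpha> * X\<^sup>2) + - (\<alpha> / 4) * x\<^sup>2)" by simp
    also have "\<dots> = \<delta> * exp (- (\<alpha> / 4) * x\<^sup>2)" by (simp only: exp_add \<delta>_def)
    finally have "exp (- \<alpha> * x\<^sup>2) \<le> \<delta> * exp (- (\<alpha> / 4) * x\<^sup>2)" .
    moreover have "norm (cos_series c 0 x * ?g x) \<le> 1 * exp (- \<alpha> * x\<^sup>2)"
      unfolding norm_mult norm_g using norm_cos_series_le[OF c, of 0 x] by (intro mult_right_mono) (auto simp: moment_0)
    moreover have "0 \<le> \<epsilon> * exp (- \<alpha> * x\<^sup>2)" using \<open>\<epsilon> \<ge> 0\<close> by simp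
    ultimately show ?thesis by linarith
  qed
  have i1: "integrable lborel (\<lambda>x. \<epsilon> * exp (- \<alpha> * x\<^sup>2))"
    by (intro integrable_mult_right integrable_exp_neg_square(1) \<alpha>)
  have i2: "integrable lborel (\<lambda>x. \<delta> * exp (- (\<alpha> / 4) * x\<^sup>2))"
    using \<alpha> by (intro integrable_mult_right integrable_exp_neg_square(1)) simp
  have "norm (\<integral>x. cos_series c 0 x * ?g x \<partial>lborel)
      \<le> (\<integral>x. \<epsilon> * exp (- \<alpha> * x\<^sup>2) + \<delta> * exp (- (\<alpha> / 4) * x\<^sup>2) \<partial>lborel)"
    using \<alpha> by (intro Bochner_Integration.integral_norm_bound_integral integral_cos_series_gauss(1)
        Bochner_Integration.integrable_add i1 i2 bound) (simp add: \<alpha>_def)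
  also have "\<dots> = \<epsilon> * sqrt (pi / \<alpha>) + \<delta> * sqrt (pi / (\<alpha> / 4))"
    using \<alpha> integrable_exp_neg_square(2)[of \<alpha>] integrable_exp_neg_square(2)[of "\<alpha> / 4"]
    by (subst Bochner_Integration.integral_add[OF i1 i2]) simp
  also have "sqrt (pi / (\<alpha> / 4)) = 2 * sqrt (pi / \<alpha>)"
  proof -
    have "pi / (\<alpha> / 4) = 2\<^sup>2 * (pi / \<alpha>)" by simp
    then show ?thesis by (simp only: real_sqrt_mult real_sqrt_abs)
  qed
  finally have I: "norm (\<integral>x. cos_series c 0 x * ?g x \<partial>lborel) \<le> sqrt (pi / \<alpha>) * (\<epsilon> + 2 * \<delta>)"
    by (simp add: algebra_simps)
  have "sqrt pi * norm (\<Sum>n. c n * exp (- of_nat n * t)) = norm (of_real (sqrt pi) * (\<Sum>n. c n * exp (- of_nat n / (4 * b))))"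
    by (simp add: norm_mult b4)
  also have "\<dots> = norm (csqrt b * (\<integral>x. cos_series c 0 x * ?g x \<partial>lborel))"
    using \<alpha> by (subst integral_cos_series_gauss(2)) (simp_all add: \<alpha>_def)
  also have "\<dots> = sqrt (norm b) * norm (\<integral>x. cos_series c 0 x * ?g x \<partial>lborel)"
    by (simp only: norm_mult norm_csqrt)
  also have "\<dots> \<le> sqrt (norm b) * (sqrt (pi / \<alpha>) * (\<epsilon> + 2 * \<delta>))"
    by (intro mult_left_mono I) simp
  also have "\<dots> = sqrt pi * (sqrt (norm b / \<alpha>) * (\<epsilon> + 2 * \<delta>))"
    by (simp add: real_sqrt_divide)
  finally have "norm (\<Sum>n. c n * exp (- of_nat n * t)) \<le> sqrt (norm b / \<alpha>) * (\<epsilon> + 2 * \<delta>)" by simp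
  moreover have "norm b / \<alpha> = norm t / Re t"
    using t t0 by (simp add: \<alpha>_eq b_def norm_divide norm_mult power2_eq_square)
  moreover have "\<delta> = exp (- (3 / 16 * Re t / (norm t)\<^sup>2 * X\<^sup>2))"
    by (simp add: \<delta>_def \<alpha>_eq)
  ultimately show ?thesis by simp
qed

end
end

section \<open>A large angular derivative at every boundary point\<close>

text \<open>Purely numerical: 1.2 (0.064 + 2 * 0.38) < 1. The threshold ln 2 enters through 2^(-1.4)
  < 0.38; for A near 0 the inequality is false.\<close>

lemma laplace_bound_less:
  fixes A :: real
  assumes A: "A \<ge> ln 2"
  shows "12 / 10 * (exp (- (A + 3)) + 2 * exp (- (24 / 10 * A))) < exp (- A)"
proof -
  have e: "exp 1 \<ge> (25 / 10 :: real)" using e_approx_32 by (simp add: abs_if split: if_splits)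
  have "exp (3::real) = exp 1 ^ 3" by (simp flip: exp_of_nat_mult)
  also have "\<dots> \<ge> (25 / 10) ^ 3" using e by (intro power_mono) auto
  finally have "exp (3::real) \<ge> (25 / 10) ^ 3" .
  then have e3: "exp (- 3) \<le> (64 / 1000 :: real)"
    by (simp add: exp_minus inverse_eq_divide field_simps power3_eq_cube)
  have e14: "exp (- (14 / 10 * A)) \<le> 38 / 100"
  proof (rule power_le_imp_le_base)
    have "exp (- (14 / 10 * A)) ^ Suc 4 = exp (- (7 * A))"
      by (simp only: exp_of_nat_mult[symmetric]) simp
    also have "\<dots> \<le> exp (- (7 * ln 2))" using A by simp
    also have "\<dots> = inverse (2 ^ 7)" using exp_of_nat_mult[of 7 "ln 2 :: real"] by (simp add: exp_minus)
    also have "\<dots> \<le> (38 / 100) ^ Suc 4" by (simp add: power_divide)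
    finally show "exp (- (14 / 10 * A)) ^ Suc 4 \<le> (38 / 100) ^ Suc 4" .
  qed simp
  have "exp (- (A + 3)) = exp (- A) * exp (- 3)" "exp (- (24 / 10 * A)) = exp (- A) * exp (- (14 / 10 * A))"
    by (simp_all add: algebra_simps flip: exp_add)
  then have "12 / 10 * (exp (- (A + 3)) + 2 * exp (- (24 / 10 * A)))
     = exp (- A) * (12 / 10 * (exp (- 3) + 2 * exp (- (14 / 10 * A))))" by (simp add: algebra_simps)
  also have "\<dots> < exp (- A) * 1" using e3 e14 by (intro mult_strict_left_mono) auto
  finally show ?thesis by simp
qed

context moment_weight
begin

context
  fixes c :: "nat \<Rightarrow> complex"
  assumes c: "\<And>n. norm (c n) \<le> recip W n"
begin

lemma exists_large_value_on_circle:
  assumes "0 < R" "R < 1"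
  shows "\<exists>z. norm z = R \<and> norm (c 0) \<le> norm (\<Sum>n. c n * z ^ n)"
proof -
  note rapid = rapid_if_le_recip[OF c]
  have cont: "continuous_on (cball 0 R) (hasse 0 c)"
    by (rule continuous_on_subset[OF continuous_on_hasse[OF rapid]]) (use assms in auto)
  have "compact (sphere (0::complex) R)" "sphere (0::complex) R \<noteq> {}" using assms by auto
  moreover have "continuous_on (sphere 0 R) (\<lambda>z. norm (hasse 0 c z))"
    by (intro continuous_on_norm continuous_on_subset[OF cont]) auto
  ultimately obtain z where z: "z \<in> sphere 0 R" "\<And>y. y \<in> sphere 0 R \<Longrightarrow> norm (hasse 0 c y) \<le> norm (hasse 0 c z)"
    using continuous_attains_sup by metis
  have "norm (hasse 0 c 0) \<le> norm (hasse 0 c z)"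
  proof (rule maximum_modulus_frontier[where f = "hasse 0 c" and S = "ball 0 R" and \<xi> = 0])
    show "hasse 0 c holomorphic_on interior (ball 0 R)"
      by (rule holomorphic_on_subset[OF holomorphic_hasse[OF rapid]]) (use assms in auto)
    show "continuous_on (closure (ball 0 R)) (hasse 0 c)" using cont assms by simp
    show "norm (hasse 0 c y) \<le> norm (hasse 0 c z)" if "y \<in> frontier (ball 0 R)" for y
      using that assms z(2)[of y] by simp
  qed (use assms in auto)
  then show ?thesis using z(1) by (intro exI[of _ z]) (simp add: hasse_def powser_zero)
qed

text \<open>Otherwise F would be flat of level p at 0, hence at most exp (- (A + 3)) for |x| <= 9
  sqrt A, and its Gaussian averages would be too small to reproduce the large value on the inner
  circle.\<close>

lemma exists_large_angular_derivative:
  assumes A: "A \<ge> ln 2" and c0: "norm (c 0) \<ge> exp (- A)" and z0: "norm z\<^sub>0 = 1"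
    and N: "A + 3 \<le> real N" "N \<le> p" and H: "Hfun W N + 25 * sqrt A \<le> Hfun W p"
  shows "\<exists>j. 2 * j < p \<and> exp (real (2 * j) - real p) * moment W (2 * j) < norm (\<Sum>n. c n * of_nat n ^ j * z\<^sub>0 ^ n)"
proof (rule ccontr)
  assume "\<not> ?thesis"
  then have small: "norm (\<Sum>n. c n * of_nat n ^ j * z\<^sub>0 ^ n) \<le> exp (real (2 * j) - real p) * moment W (2 * j)"
    if "2 * j < p" for j
    using that by force
  have A0: "A > 0" using A ln_2_less_1 by (smt (verit) ln_gt_zero)
  define d where "d n = c n * z\<^sub>0 ^ n" for n
  have d: "norm (d n) \<le> recip W n" for n using c[of n] z0 by (simp add: d_def norm_mult norm_power)
  obtain z where z: "norm z = exp (- pi)" "norm (c 0) \<le> norm (\<Sum>n. c n * z ^ n)"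
    using exists_large_value_on_circle[of "exp (- pi)"] by auto
  have z_nz: "z \<noteq> 0" "z\<^sub>0 \<noteq> 0" using z(1) z0 by auto
  define t where "t = Ln (z\<^sub>0 / z)"
  have "norm (z\<^sub>0 / z) = exp pi"
    by (simp add: norm_divide z(1) z0 exp_minus inverse_eq_divide)
  then have Re_t: "Re t = pi"
    using z_nz by (simp add: t_def)
  have Im_t: "\<bar>Im t\<bar> \<le> pi"
    using z_nz mpi_less_Im_Ln[of "z\<^sub>0 / z"] Im_Ln_le_pi[of "z\<^sub>0 / z"] by (simp add: t_def)
  have "exp (- t) = z / z\<^sub>0" using z_nz by (simp add: t_def exp_minus)
  then have "exp (- of_nat n * t) = (z / z\<^sub>0) ^ n" for n
    using exp_of_nat_mult[of n "- t"] by simp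
  then have eq: "(\<Sum>n. d n * exp (- of_nat n * t)) = (\<Sum>n. c n * z ^ n)"
    using z_nz by (simp add: d_def power_divide)
  have "(norm t)\<^sup>2 = pi\<^sup>2 + (Im t)\<^sup>2" by (simp add: cmod_power2 Re_t)
  moreover have "(Im t)\<^sup>2 \<le> pi\<^sup>2" using Im_t abs_le_square_iff[of "Im t" pi] by simp
  ultimately have t2: "(norm t)\<^sup>2 \<le> 2 * pi\<^sup>2" "norm t > 0" by (auto simp: Re_t simp flip: zero_less_power2)
  \<comment> \<open>The factor 9 is limited by 9 e < 25, the distance that Bang's steps can cover,
    and is large enough for 3/16 * 81 / (2 pi) > 2.4, the exponent of the Gaussian tail.\<close>
  define X where "X = 9 * sqrt A"
  have flat: "norm (cos_series d 0 x) \<le> exp (- (A + 3))" if x: "\<bar>x\<bar> \<le> X" for x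
  proof -
    have "norm (cos_series d 0 x) \<le> exp (- real N)"
    proof (rule norm_cos_series_le_exp[OF d _ N(2)])
      fix k assume k: "k < p"
      show "norm (cos_series d k 0) \<le> exp (real k - real p) * moment W k"
      proof (cases "odd k")
        case True
        then have "cos_series d k 0 = 0" by (simp add: cos_series_def cos_deriv_0_odd)
        then show ?thesis using moment_pos[of k] by simp
      next
        case False
        then obtain j where j: "k = 2 * j" by (auto elim: evenE)
        have eq: "d n * of_real (sqrt (real n) ^ k) * cos_deriv k (sqrt (real n) * 0)
            = (-1) ^ j * (c n * of_nat n ^ j * z\<^sub>0 ^ n)" for n
        proof -
          have "sqrt (real n) ^ k = real n ^ j" by (simp add: j power_mult)
          then show ?thesis unfolding j mult_zero_right cos_deriv_0_even d_def by (simp add: mult_ac)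
        qed
        have "cos_series d k 0 = (\<Sum>n. (-1) ^ j * (c n * of_nat n ^ j * z\<^sub>0 ^ n))"
          unfolding cos_series_def eq ..
        also have "\<dots> = (-1) ^ j * (\<Sum>n. c n * of_nat n ^ j * z\<^sub>0 ^ n)"
        proof (rule suminf_mult)
          have "summable (\<lambda>n. (-1) ^ j * (c n * of_nat n ^ j * z\<^sub>0 ^ n))"
            using cos_series_sums[OF d, of k 0] unfolding eq by (rule sums_summable)
          then show "summable (\<lambda>n. c n * of_nat n ^ j * z\<^sub>0 ^ n)"
            by (subst (asm) summable_cmult_iff) auto
        qed
        finally show ?thesis using small[of j] k j by (simp add: norm_mult norm_power)
      qed
    next
      have "exp 1 * \<bar>x\<bar> \<le> 272 / 100 * X" using x e_less_272 by (intro mult_mono) auto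
      also have "\<dots> \<le> 25 * sqrt A" using A0 by (simp add: X_def)
      finally show "exp 1 * \<bar>x\<bar> \<le> Hfun W p - Hfun W N" using H by linarith
    qed
    also have "\<dots> \<le> exp (- (A + 3))" using N(1) by simp
    finally show ?thesis .
  qed
  have "exp (- A) \<le> norm (\<Sum>n. d n * exp (- of_nat n * t))" using c0 z(2) eq by simp
  also have "\<dots> \<le> sqrt (norm t / Re t) * (exp (- (A + 3)) + 2 * exp (- (3 / 16 * Re t / (norm t)\<^sup>2 * X\<^sup>2)))"
    using A0 by (intro norm_laplace_le[OF d _ _ flat]) (auto simp: Re_t X_def)
  also have "\<dots> \<le> 12 / 10 * (exp (- (A + 3)) + 2 * exp (- (24 / 10 * A)))"
  proof (intro mult_mono add_mono order_refl)
    show "sqrt (norm t / Re t) \<le> 12 / 10"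
    proof (rule real_le_lsqrt)
      show "norm t / Re t \<le> (12 / 10)\<^sup>2"
      proof (rule power2_le_imp_le)
        have "(norm t / Re t)\<^sup>2 \<le> 2" using t2(1) by (simp add: Re_t power_divide field_simps)
        also have "2 \<le> ((12 / 10)\<^sup>2 :: real)\<^sup>2" by (simp add: power2_eq_square)
        finally show "(norm t / Re t)\<^sup>2 \<le> ((12 / 10)\<^sup>2)\<^sup>2" .
      qed simp
    qed simp
    have "24 / 10 * A \<le> 3 / 16 * 81 * A / (2 * pi)"
    proof -
      have "24 / 10 * A * (2 * pi) \<le> 24 / 10 * A * (2 * 3.1415926535899)"
        using A0 pi_approx(2) by (intro mult_left_mono) auto
      also have "\<dots> \<le> 3 / 16 * 81 * A" using A0 by simp
      finally show ?thesis by (simp add: field_simps)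
    qed
    also have "\<dots> = 3 / 16 * pi / (2 * pi\<^sup>2) * X\<^sup>2"
      using A0 by (simp add: X_def power_mult_distrib power2_eq_square)
    also have "\<dots> \<le> 3 / 16 * Re t / (norm t)\<^sup>2 * X\<^sup>2"
      unfolding Re_t using t2 by (intro mult_right_mono divide_left_mono) auto
    finally show "exp (- (3 / 16 * Re t / (norm t)\<^sup>2 * X\<^sup>2)) \<le> exp (- (24 / 10 * A))" by simp
  qed auto
  also have "\<dots> < exp (- A)" by (rule laplace_bound_less[OF A])
  finally show False by simp
qed

end
end

section \<open>Few zeros near a boundary point\<close>

text \<open>A single term of the exponential series; it plays the part of Stirling's
  formula.\<close>

lemma power_self_le_exp_fact: "real n ^ n \<le> exp (real n) * fact n"
proof -
  have "(\<Sum>k\<in>{n}. inverse (fact k) * real n ^ k) \<le> exp (real n)"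
    unfolding exp_def using summable_exp[of "real n"] by (simp only: scaleR_conv_of_real of_real_eq_id id_apply)
      (rule sum_le_suminf, auto simp: divide_inverse mult_ac)
  then show ?thesis by (simp add: field_simps)
qed

text \<open>Surplus zeros are discarded, since the interpolation estimate is to be applied with
  exactly p of them.\<close>

lemma ex_sum_eq_of_le:
  fixes \<mu> :: "'a \<Rightarrow> nat"
  assumes "finite F" "p \<le> sum \<mu> F"
  shows "\<exists>\<nu>. (\<forall>z. \<nu> z \<le> \<mu> z) \<and> sum \<nu> F = p"
  using assms(2)
proof (induction "sum \<mu> F - p" arbitrary: \<mu>)
  case 0
  then show ?case by (intro exI[of _ \<mu>]) auto
next
  case (Suc d)
  then have "sum \<mu> F = Suc (p + d)" by linarith
  from sum_eq_SucE[OF assms(1) this] obtain w where w: "sum (\<mu>(w := \<mu> w - 1)) F = p + d" by metis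
  with Suc obtain \<nu> where \<nu>: "\<forall>z. \<nu> z \<le> (\<mu>(w := \<mu> w - 1)) z" "sum \<nu> F = p"
    by (metis add_diff_cancel_left' le_add1)
  have "\<nu> z \<le> \<mu> z" for z
  proof -
    have "\<nu> z \<le> (\<mu>(w := \<mu> w - 1)) z" using \<nu>(1) by blast
    also have "\<dots> \<le> \<mu> z" by simp
    finally show ?thesis .
  qed
  with \<nu>(2) show ?case by blast
qed

context moment_weight
begin

context
  fixes c :: "nat \<Rightarrow> complex"
  assumes c: "\<And>n. norm (c n) \<le> recip W n"
begin

text \<open>The falling factorial of n is at most n^m = (sqrt n)^(2 m); this links division by
  zeros, measured by Hasse norms, to the even moments.\<close>

lemma fact_hasse_norm_le: "fact m * hasse_norm m c \<le> moment W (2 * m)"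
proof -
  have "fact m * hasse_norm m c = (\<Sum>n. fact m * (real (n choose m) * norm (c n)))"
    unfolding hasse_norm_def by (rule suminf_mult[symmetric]) (rule rapidD[OF rapid_if_le_recip[OF c]])
  also have "\<dots> \<le> moment W (2 * m)"
    unfolding moment_def
  proof (intro suminf_le summable_mult rapidD[OF rapid_if_le_recip[OF c]] summable_moment)
    fix n
    have "fact m * (n choose m) \<le> n ^ m"
    proof (cases "m \<le> n")
      case True
      then have "fact n div fact (n - m) = fact m * (n choose m)"
        using binomial_fact_lemma[OF True] by (metis mult.assoc mult.commute nonzero_mult_div_cancel_left fact_nonzero)
      then show ?thesis using fact_div_fact_le_pow[OF True] by simp
    qed (simp add: binomial_eq_0)
    then have "fact m * real (n choose m) \<le> real n ^ m"
      by (metis of_nat_fact of_nat_le_iff of_nat_mult of_nat_power)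
    then have "fact m * real (n choose m) * norm (c n) \<le> real n ^ m * recip W n"
      by (intro mult_mono c) auto
    then show "fact m * (real (n choose m) * norm (c n)) \<le> sqrt (real n) ^ (2 * m) * recip W n"
      by (simp add: power_mult mult.assoc)
  qed
  finally show ?thesis .
qed

text \<open>
  Interpolates between the Hasse derivatives (\<open>j = 0\<close>) and the angular derivatives (\<open>i = 0\<close>); the
  recursion below is that of the Stirling numbers.
\<close>

definition mixed_sum :: "nat \<Rightarrow> nat \<Rightarrow> complex \<Rightarrow> complex" where
  "mixed_sum j i z = (\<Sum>n. of_nat n ^ j * (of_nat (n choose i) * c n * z ^ n))"

lemma mixed_sum_sums:
  assumes "norm z = 1"
  shows "(\<lambda>n. of_nat n ^ j * (of_nat (n choose i) * c n * z ^ n)) sums mixed_sum j i z"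
  unfolding mixed_sum_def
proof (intro summable_sums summable_comparison_test'[OF summable_moment[of "2 * (j + i)"]])
  fix n
  have "n choose i \<le> n ^ i"
    using binomial_le_pow[of i n] by (cases "i \<le> n") (auto simp: binomial_eq_0)
  then have "real (n choose i) \<le> real n ^ i" by (simp flip: of_nat_power)
  then have "real n ^ j * (real (n choose i) * norm (c n)) \<le> real n ^ j * (real n ^ i * recip W n)"
    by (intro mult_left_mono mult_mono c) auto
  then show "norm (of_nat n ^ j * (of_nat (n choose i) * c n * z ^ n)) \<le> sqrt (real n) ^ (2 * (j + i)) * recip W n"
    by (simp add: norm_mult norm_power assms power_mult power_add mult.assoc)
qed

lemma mixed_sum_Suc:
  assumes "norm z = 1"
  shows "mixed_sum (Suc j) i z = of_nat i * mixed_sum j i z + of_nat (Suc i) * mixed_sum j (Suc i) z"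
proof -
  have "(\<lambda>n. of_nat i * (of_nat n ^ j * (of_nat (n choose i) * c n * z ^ n))
       + of_nat (Suc i) * (of_nat n ^ j * (of_nat (n choose Suc i) * c n * z ^ n)))
     sums (of_nat i * mixed_sum j i z + of_nat (Suc i) * mixed_sum j (Suc i) z)"
    by (intro sums_add sums_mult mixed_sum_sums assms)
  moreover have "of_nat i * (of_nat n ^ j * (of_nat (n choose i) * c n * z ^ n))
       + of_nat (Suc i) * (of_nat n ^ j * (of_nat (n choose Suc i) * c n * z ^ n))
      = of_nat n ^ Suc j * (of_nat (n choose i) * c n * z ^ n)" for n
  proof -
    have "i * (n choose i) + Suc i * (n choose Suc i) = n * (n choose i)"
    proof (cases "i \<le> n")
      case True
      have "Suc i * (n choose Suc i) = (n - i) * (n choose i)"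
        by (metis binomial_absorb_comp binomial_absorption mult.commute)
      then show ?thesis using True by (simp flip: add_mult_distrib)
    qed (simp add: binomial_eq_0)
    then have "of_nat i * of_nat (n choose i) + of_nat (Suc i) * of_nat (n choose Suc i)
       = (of_nat n * of_nat (n choose i) :: complex)"
      by (metis of_nat_add of_nat_mult)
    then have "(of_nat i * of_nat (n choose i) + of_nat (Suc i) * of_nat (n choose Suc i)) * (of_nat n ^ j * c n * z ^ n)
       = (of_nat n * of_nat (n choose i)) * (of_nat n ^ j * c n * z ^ n)" by (simp only:)
    then show ?thesis by (simp only: distrib_right distrib_left power_Suc mult_ac)
  qed
  ultimately show ?thesis
    using mixed_sum_sums[OF assms, of "Suc j" i] by (simp only: sums_unique2)
qed

lemma norm_mixed_sum_0:
  assumes "norm z = 1"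
  shows "norm (mixed_sum 0 i z) = norm (hasse i c z)"
proof -
  have "(\<lambda>n. z ^ i * (of_nat (n choose i) * c n * z ^ (n - i))) sums (z ^ i * hasse i c z)"
    using hasse_sums[OF rapid_if_le_recip[OF c], of z i] assms by (intro sums_mult) auto
  moreover have "z ^ i * (of_nat (n choose i) * c n * z ^ (n - i)) = of_nat n ^ 0 * (of_nat (n choose i) * c n * z ^ n)" for n
    by (cases "i \<le> n") (simp_all add: binomial_eq_0 mult_ac flip: power_add)
  ultimately have "mixed_sum 0 i z = z ^ i * hasse i c z"
    using mixed_sum_sums[OF assms, of 0 i] by (simp only: sums_unique2)
  then show ?thesis using assms by (simp add: norm_mult norm_power)
qed

text \<open>Following the recursion avoids any estimate of Stirling numbers. Its diagonal term
  carries a factor i and the bound of order l = i + j; as i <= m - l, that factor is absorbed by (m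
  - l)! and leaves r times the bound of order l + 1. Hence each angular derivative costs only 1 + r.
  The restriction to at most half of m secures i <= m - l.\<close>

lemma norm_mixed_sum_le:
  assumes z: "norm z = 1" and r: "r \<ge> 0" and M: "M \<ge> 0"
    and hasse: "\<And>i. i \<le> m \<Longrightarrow> fact i * norm (hasse i c z) \<le> r ^ (m - i) / fact (m - i) * M"
  shows "2 * (i + j) \<le> m \<Longrightarrow>
    fact i * norm (mixed_sum j i z) \<le> (1 + r) ^ j * (r ^ (m - (i + j)) / fact (m - (i + j)) * M)"
proof (induction j arbitrary: i)
  case 0
  then show ?case using hasse[of i] by (simp add: norm_mixed_sum_0[OF z])
next
  case (Suc j)
  define l where "l = i + j"
  define Q where "Q k = r ^ (m - k) / fact (m - k) * M" for k
  have ml: "m - l = Suc (m - Suc l)" "i \<le> m - l" using Suc.prems by (auto simp: l_def)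
  have Q: "real i * Q l \<le> r * Q (Suc l)"
  proof -
    have "real (m - l) * Q l = r * Q (Suc l)"
      unfolding Q_def ml(1) by (simp del: of_nat_Suc)
    moreover have "real i * Q l \<le> real (m - l) * Q l"
      using ml(2) r M by (intro mult_right_mono) (auto simp: Q_def)
    ultimately show ?thesis by simp
  qed
  have "fact i * norm (mixed_sum (Suc j) i z)
      \<le> fact i * (real i * norm (mixed_sum j i z) + real (Suc i) * norm (mixed_sum j (Suc i) z))"
    unfolding mixed_sum_Suc[OF z]
    by (intro mult_left_mono order_trans[OF norm_triangle_ineq]) (simp_all only: norm_mult norm_of_nat fact_ge_zero order_refl)
  also have "\<dots> = real i * (fact i * norm (mixed_sum j i z)) + fact (Suc i) * norm (mixed_sum j (Suc i) z)"
    by (simp add: algebra_simps)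
  also have "\<dots> \<le> real i * ((1 + r) ^ j * Q l) + (1 + r) ^ j * Q (Suc l)"
    using Suc.IH[of i] Suc.IH[of "Suc i"] Suc.prems unfolding Q_def l_def
    by (intro add_mono mult_left_mono) auto
  also have "\<dots> = (1 + r) ^ j * (real i * Q l + Q (Suc l))" by (simp add: algebra_simps)
  also have "\<dots> \<le> (1 + r) ^ j * (r * Q (Suc l) + Q (Suc l))"
    using Q r by (intro mult_left_mono) auto
  also have "\<dots> = (1 + r) ^ Suc j * Q (i + Suc j)" by (simp add: l_def algebra_simps)
  finally show ?case by (simp only: Q_def)
qed

lemma angular_derivative_le_of_zeros:
  assumes "finite F" "F \<subseteq> cball 0 1" "norm z\<^sub>0 = 1" "\<And>z. z \<in> F \<Longrightarrow> dist z\<^sub>0 z \<le> r" "r \<ge> 0"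
    and "\<And>z k. z \<in> F \<Longrightarrow> k < \<mu> z \<Longrightarrow> hasse k c z = 0"
    and "sum \<mu> F = m" "2 * j \<le> m"
  shows "norm (\<Sum>n. c n * of_nat n ^ j * z\<^sub>0 ^ n) \<le> (1 + r) ^ j * (r ^ (m - j) / fact (m - j) * moment W (2 * m))"
proof -
  have "fact i * norm (hasse i c z\<^sub>0) \<le> r ^ (m - i) / fact (m - i) * moment W (2 * m)" if i: "i \<le> m" for i
  proof -
    have "fact i * norm (hasse i c z\<^sub>0) \<le> fact i * (real (m choose i) * r ^ (m - i) * hasse_norm m c)"
      using assms i by (intro mult_left_mono norm_hasse_le_of_zeros[where F = F and \<mu> = \<mu>] rapid_if_le_recip[OF c]) auto
    also have "\<dots> = r ^ (m - i) / fact (m - i) * (fact m * hasse_norm m c)"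
      using i by (simp add: binomial_fact)
    also have "\<dots> \<le> r ^ (m - i) / fact (m - i) * moment W (2 * m)"
      using \<open>r \<ge> 0\<close> by (intro mult_left_mono fact_hasse_norm_le) auto
    finally show ?thesis .
  qed
  from norm_mixed_sum_le[OF assms(3,5) less_imp_le[OF moment_pos] this, of 0 j] assms(8)
  have "norm (mixed_sum j 0 z\<^sub>0) \<le> (1 + r) ^ j * (r ^ (m - j) / fact (m - j) * moment W (2 * m))" by simp
  moreover have "mixed_sum j 0 z\<^sub>0 = (\<Sum>n. c n * of_nat n ^ j * z\<^sub>0 ^ n)"
    unfolding mixed_sum_def by (simp add: mult_ac)
  ultimately show ?thesis by simp
qed

text \<open>Put n = p - j, so that p <= 2 n. With p zeros the derivative would be at most (1.1 r)^n
  / n! times \<open>moment W (2 * p)\<close>. Inserting r <= n h^2 / 10, n^n <= e^n n! and the trade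
  of 2 n orders for h^(2 n) leaves (1.1 e / 10)^n \<open>moment W (2 * j)\<close>. The 20 in r is
  chosen so that 1.1 e^2 < 10, which makes this at most e^(-n)
  \<open>moment W (2 * j)\<close>.\<close>

lemma few_zeros_near:
  assumes large: "exp (real (2 * j) - real p) * moment W (2 * j) < norm (\<Sum>n. c n * of_nat n ^ j * z\<^sub>0 ^ n)" "2 * j < p"
    and h: "0 < h" "h \<le> hfun W (2 * p)" "h \<le> 1 / real p" and r: "r = real p * h\<^sup>2 / 20"
    and F: "finite F" "F \<subseteq> cball 0 1" "norm z\<^sub>0 = 1" "\<And>z. z \<in> F \<Longrightarrow> dist z\<^sub>0 z \<le> r"
    and zeros: "\<And>z k. z \<in> F \<Longrightarrow> k < \<mu> z \<Longrightarrow> hasse k c z = 0"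
  shows "sum \<mu> F < p"
proof (rule ccontr)
  assume "\<not> sum \<mu> F < p"
  then obtain \<nu> where \<nu>: "\<And>z. \<nu> z \<le> \<mu> z" "sum \<nu> F = p"
    using ex_sum_eq_of_le[OF F(1), of p \<mu>] by auto
  define n where "n = p - j"
  have n: "n + j = p" "j \<le> n" "0 < n" "real p \<le> 2 * real n" using large(2) by (auto simp: n_def)
  have p: "p \<ge> 1" using large(2) by simp
  have r0: "r \<ge> 0" using h by (simp add: r)
  \<comment> \<open>Here h <= 1/p enters: it keeps r below 1/20, so that the powers of 1 + r stay
    harmless.\<close>
  have "real p * h\<^sup>2 \<le> real p * (1 / real p)\<^sup>2" using h by (intro mult_left_mono power_mono) auto
  also have "\<dots> \<le> 1" using p by (simp add: power2_eq_square)
  finally have r1: "1 + r \<le> 11 / 10" using r0 by (simp add: r)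
  have "norm (\<Sum>n. c n * of_nat n ^ j * z\<^sub>0 ^ n) \<le> (1 + r) ^ j * (r ^ n / fact n * moment W (2 * p))"
    unfolding n_def
  proof (rule angular_derivative_le_of_zeros[OF F r0 _ \<nu>(2)])
    show "hasse k c z = 0" if "z \<in> F" "k < \<nu> z" for z k
      using zeros[OF that(1)] that(2) \<nu>(1)[of z] by simp
  qed (use large(2) in auto)
  also have "\<dots> \<le> (11 / 10) ^ n * (r ^ n / fact n * moment W (2 * p))"
  proof (rule mult_right_mono)
    have "(1 + r) ^ j \<le> (1 + r) ^ n" using n r0 by (intro power_increasing) auto
    also have "\<dots> \<le> (11 / 10) ^ n" using r0 r1 by (intro power_mono) auto
    finally show "(1 + r) ^ j \<le> (11 / 10) ^ n" .
  qed (use r0 moment_pos[of "2 * p"] in auto)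
  also have "\<dots> = (11 / 10) ^ n * ((real p / 20) ^ n / fact n * (h ^ (2 * n) * moment W (2 * p)))"
    by (simp add: r power_mult power_mult_distrib power_divide)
  also have "\<dots> \<le> (11 / 10) ^ n * (exp (real n) / 10 ^ n * moment W (2 * j))"
  proof (intro mult_left_mono mult_mono)
    have "(real p / 20) ^ n \<le> (real n / 10) ^ n" using n by (intro power_mono) auto
    also have "\<dots> \<le> exp (real n) * fact n / 10 ^ n"
      using power_self_le_exp_fact[of n] by (simp add: power_divide divide_right_mono)
    finally show "(real p / 20) ^ n / fact n \<le> exp (real n) / 10 ^ n" by (simp add: field_simps)
    have "2 * p = 2 * j + 2 * n" using n by simp
    then show "h ^ (2 * n) * moment W (2 * p) \<le> moment W (2 * j)"
      using moment_add_le[of h "2 * j" "2 * n"] h by simp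
  qed (use h moment_pos[of "2 * p"] in auto)
  also have "\<dots> = (11 / 10 * (exp 1 / 10)) ^ n * moment W (2 * j)"
    unfolding power_mult_distrib power_divide using exp_of_nat_mult[of n "1 :: real"] by simp
  also have "\<dots> \<le> exp (- real n) * moment W (2 * j)"
  proof (rule mult_right_mono)
    have "exp 1 * exp 1 \<le> 272 / 100 * (272 / 100 :: real)"
      using e_less_272 by (intro mult_mono) auto
    then have "11 / 10 * (exp 1 / 10) \<le> exp (- 1 :: real)"
      by (simp add: exp_minus field_simps)
    then have "(11 / 10 * (exp 1 / 10)) ^ n \<le> exp (- 1 :: real) ^ n" by (intro power_mono) auto
    then show "(11 / 10 * (exp 1 / 10)) ^ n \<le> exp (- real n)"
      using exp_of_nat_mult[of n "- 1 :: real"] by simp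
  qed (use moment_pos[of "2 * j"] in auto)
  also have "\<dots> \<le> exp (real (2 * j) - real p) * moment W (2 * j)"
    using n moment_pos[of "2 * j"] by (intro mult_right_mono) auto
  finally show False using large(1) by simp
qed

end
end

section \<open>Counting all zeros\<close>

lemma sum_le_sum_cover:
  fixes \<mu> :: "'a \<Rightarrow> nat"
  assumes "finite F" "finite I" "\<And>z. z \<in> F \<Longrightarrow> \<exists>i\<in>I. P i z"
  shows "sum \<mu> F \<le> (\<Sum>i\<in>I. sum \<mu> {z \<in> F. P i z})"
proof -
  have "sum \<mu> F \<le> (\<Sum>z\<in>F. \<Sum>i\<in>I. if P i z then \<mu> z else 0)"
  proof (rule sum_mono)
    fix z assume "z \<in> F"
    then obtain i where i: "i \<in> I" "P i z" using assms(3) by blast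
    then have "\<mu> z = (if P i z then \<mu> z else 0)" by simp
    also have "\<dots> \<le> (\<Sum>i\<in>I. if P i z then \<mu> z else 0)"
      using i(1) assms(2) by (intro member_le_sum) auto
    finally show "\<mu> z \<le> (\<Sum>i\<in>I. if P i z then \<mu> z else 0)" .
  qed
  also have "\<dots> = (\<Sum>i\<in>I. \<Sum>z\<in>F. if P i z then \<mu> z else 0)" by (rule sum.swap)
  also have "\<dots> = (\<Sum>i\<in>I. sum \<mu> {z \<in> F. P i z})"
    using assms(1) by (intro sum.cong refl sum.inter_filter[symmetric])
  finally show ?thesis .
qed

lemma norm_cis_diff_le: "norm (cis a - cis b) \<le> \<bar>a - b\<bar>"
proof -
  have "cis a - cis b = cis b * (iexp (a - b) - 1)"
    by (simp add: cis_conv_exp algebra_simps flip: exp_add)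
  then have "norm (cis a - cis b) = norm (iexp (a - b) - 1)" by (simp add: norm_mult)
  also have "\<dots> \<le> \<bar>a - b\<bar>" using iexp_approx1[of "a - b" 0] by simp
  finally show ?thesis .
qed

text \<open>The distance r is shared equally: the radial gap is below r/2, and rounding the angle
  down to a multiple of 2 pi / L costs at most 2 pi / L <= r/2.\<close>

lemma dist_root_of_unity:
  assumes L: "4 * pi \<le> r * real L" "L > 0" and z: "1 - r / 2 < norm z" "norm z \<le> 1" "r > 0"
  shows "\<exists>l<L. dist (cis (2 * pi * real l / real L)) z \<le> r"
proof (cases "z = 0")
  case True
  \<comment> \<open>For z = 0 the hypothesis 1 - r/2 < 0 means r > 2, so every root of unity is
    close enough.\<close>
  then have "norm (cis (2 * pi * real 0 / real L)) \<le> r" using z by simp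
  then show ?thesis using L True by (intro exI[of _ 0]) auto
next
  case False
  define \<phi> where "\<phi> = Arg2pi z"
  have \<phi>: "0 \<le> \<phi>" "\<phi> < 2 * pi" by (simp_all add: \<phi>_def Arg2pi_ge_0 Arg2pi_lt_2pi)
  have z_eq: "z = of_real (norm z) * cis \<phi>"
    using Arg2pi_eq[of z] by (simp add: \<phi>_def cis_conv_exp)
  define l where "l = nat \<lfloor>\<phi> * real L / (2 * pi)\<rfloor>"
  have nn: "0 \<le> \<phi> * real L / (2 * pi)" using \<phi> by simp
  have l: "real l \<le> \<phi> * real L / (2 * pi)" "\<phi> * real L / (2 * pi) < real l + 1"
    unfolding l_def using nn by linarith+
  have "\<phi> * real L / (2 * pi) < real L"
    using \<phi> L by (simp add: field_simps)
  with l(1) have lL: "l < L" by linarith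
  define \<psi> where "\<psi> = 2 * pi * real l / real L"
  have "\<psi> \<le> \<phi>" "\<phi> \<le> \<psi> + 2 * pi / real L"
    using l L by (simp_all add: \<psi>_def field_simps)
  moreover have "2 * pi / real L \<le> r / 2" using L by (simp add: field_simps)
  ultimately have "\<bar>\<psi> - \<phi>\<bar> \<le> r / 2" by linarith
  then have 1: "norm (cis \<psi> - cis \<phi>) \<le> r / 2" using norm_cis_diff_le order_trans by blast
  have "cis \<phi> - z = of_real (1 - norm z) * cis \<phi>" by (subst z_eq) (simp add: algebra_simps)
  then have 2: "norm (cis \<phi> - z) = 1 - norm z" using z by (simp add: norm_mult del: of_real_diff)
  have "norm (cis \<psi> - z) \<le> norm (cis \<psi> - cis \<phi>) + norm (cis \<phi> - z)"
    using norm_triangle_ineq[of "cis \<psi> - cis \<phi>" "cis \<phi> - z"] by simp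
  also have "\<dots> \<le> r" using 1 2 z by linarith
  finally show ?thesis using lL by (auto simp: dist_norm \<psi>_def)
qed

context moment_weight
begin

context
  fixes c :: "nat \<Rightarrow> complex"
  assumes c: "\<And>n. norm (c n) \<le> recip W n"
begin

lemma norm_hasse_0_le: "norm z \<le> 1 \<Longrightarrow> norm (hasse 0 c z) \<le> 1"
  using norm_hasse_le[OF rapid_if_le_recip[OF c], of z 0] fact_hasse_norm_le[OF c, of 0] by (simp add: moment_0)

text \<open>Jensen's inequality with supremum bound 1: k zeros give exp (- A) <= (1 - w)^k <= exp (-
  k w).\<close>

lemma inner_zeros_le:
  assumes "finite F" "F \<subseteq> cball 0 (1 - w)" "0 < w" "w < 1" "norm (c 0) \<ge> exp (- A)"
    and zeros: "\<And>z k. z \<in> F \<Longrightarrow> k < \<mu> z \<Longrightarrow> hasse k c z = 0"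
  shows "real (sum \<mu> F) \<le> A / w"
proof -
  have "norm (c 0) \<le> (1 - w) ^ sum \<mu> F * 1"
    by (rule norm_coeff_0_le_of_zeros[OF rapid_if_le_recip[OF c] assms(1,2) _ zeros])
      (use assms(3) in \<open>auto simp: norm_hasse_0_le\<close>)
  with assms(5) have "exp (- A) \<le> (1 - w) ^ sum \<mu> F * 1" by linarith
  also have "\<dots> \<le> exp (- w) ^ sum \<mu> F * 1"
    using assms(4) exp_ge_add_one_self[of "- w"] by (intro mult_right_mono power_mono) auto
  also have "\<dots> = exp (- (real (sum \<mu> F) * w))"
    using exp_of_nat_mult[of "sum \<mu> F" "- w"] by simp
  finally have "real (sum \<mu> F) * w \<le> A" by simp
  then show ?thesis using assms(3) by (simp add: field_simps)
qed

text \<open>The inner disc contributes at most 2 A / r <= 2 p / r = 40 / h^2. The boundary discs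
  contribute at most (4 pi / r + 1) p = 80 pi / h^2 + p, and p <= 1 / h^2. The total 41 + 80 pi is
  below 300.\<close>

lemma zeros_le_of_ln2_le:
  assumes A: "A \<ge> ln 2" and c0: "norm (c 0) \<ge> exp (- A)"
    and N: "A + 3 \<le> real N" "N \<le> p" and H: "Hfun W N + 25 * sqrt A \<le> Hfun W p"
    and h: "0 < h" "h \<le> hfun W (2 * p)" "h \<le> 1 / real p"
    and F: "finite F" "F \<subseteq> cball 0 1"
    and zeros: "\<And>z k. z \<in> F \<Longrightarrow> k < \<mu> z \<Longrightarrow> hasse k c z = 0"
  shows "real (sum \<mu> F) \<le> 300 / h\<^sup>2"
proof -
  have A0: "A > 0" using A ln_gt_zero[of 2] by linarith
  have p: "real p \<ge> A + 3" using N by (meson of_nat_le_iff order_trans)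
  then have p0: "real p > 0" "real p \<ge> 1" using A0 by auto
  have "1 / real p \<le> 1" using p0 by simp
  then have h1: "h \<le> 1" "real p * h \<le> 1"
    using h p0 by (linarith, simp add: field_simps)
  define r where "r = real p * h\<^sup>2 / 20"
  have r0: "r > 0" using p0 h by (simp add: r_def)
  have "real p * h\<^sup>2 = (real p * h) * h" by (simp add: power2_eq_square)
  also have "\<dots> \<le> 1 * 1" using h1 h by (intro mult_mono) auto
  finally have r1: "r \<le> 1 / 20" by (simp add: r_def)
  define L where "L = nat \<lceil>4 * pi / r\<rceil>"
  have "0 \<le> 4 * pi / r" using r0 by simp
  then have L: "4 * pi / r \<le> real L" "real L \<le> 4 * pi / r + 1" unfolding L_def by linarith+
  have "4 * pi / r > 0" using r0 by simp
  then have L0: "L > 0" using L(1) by (intro gr0I) simp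
  have L': "4 * pi \<le> r * real L" using L(1) r0 by (simp add: field_simps)
  define P where "P i z \<longleftrightarrow> (case i of None \<Rightarrow> norm z \<le> 1 - r / 2 | Some l \<Rightarrow> dist (cis (2 * pi * real l / real L)) z \<le> r)"
    for i :: "nat option" and z :: complex
  have "\<exists>i\<in>insert None (Some ` {..<L}). P i z" if z: "z \<in> F" for z
  proof (cases "norm z \<le> 1 - r / 2")
    case True
    then show ?thesis by (intro bexI[of _ None]) (auto simp: P_def)
  next
    case False
    have "norm z \<le> 1" using F(2) z by auto
    with False obtain l where "l < L" "dist (cis (2 * pi * real l / real L)) z \<le> r"
      using dist_root_of_unity[OF L' L0, of z] r0 by auto
    then show ?thesis by (intro bexI[of _ "Some l"]) (auto simp: P_def)
  qed
  then have "sum \<mu> F \<le> (\<Sum>i\<in>insert None (Some ` {..<L}). sum \<mu> {z \<in> F. P i z})"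
    using F(1) by (intro sum_le_sum_cover) auto
  also have "\<dots> = sum \<mu> {z \<in> F. P None z} + (\<Sum>l<L. sum \<mu> {z \<in> F. P (Some l) z})"
    by (subst sum.insert) (auto simp: sum.reindex)
  also have "\<dots> \<le> sum \<mu> {z \<in> F. P None z} + (\<Sum>l<L. p)"
  proof (intro add_left_mono sum_mono less_imp_le)
    fix l
    let ?z = "cis (2 * pi * real l / real L)"
    obtain j where j: "2 * j < p"
       "exp (real (2 * j) - real p) * moment W (2 * j) < norm (\<Sum>n. c n * of_nat n ^ j * ?z ^ n)"
      using exists_large_angular_derivative[OF c A c0 _ N H, of ?z] by auto
    show "sum \<mu> {z \<in> F. P (Some l) z} < p"
      using F zeros by (intro few_zeros_near[OF c j(2,1) h r_def]) (auto simp: P_def)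
  qed
  finally have "real (sum \<mu> F) \<le> real (sum \<mu> {z \<in> F. P None z} + (\<Sum>l<L. p))"
    by (simp only: of_nat_le_iff)
  also have "\<dots> = real (sum \<mu> {z \<in> F. P None z}) + real L * real p" by simp
  also have "\<dots> \<le> A / (r / 2) + (4 * pi / r + 1) * real p"
  proof (intro add_mono mult_right_mono L(2))
    show "real (sum \<mu> {z \<in> F. P None z}) \<le> A / (r / 2)"
      using F zeros r0 r1 c0 by (intro inner_zeros_le) (auto simp: P_def)
  qed simp
  also have "\<dots> \<le> real p / (r / 2) + (4 * pi / r + 1) * real p"
    using p r0 by (intro add_right_mono divide_right_mono) auto
  also have "\<dots> = (40 + 80 * pi) / h\<^sup>2 + real p"
    using p0 h by (simp add: r_def field_simps power2_eq_square)
  also have "\<dots> \<le> (40 + 80 * pi) / h\<^sup>2 + 1 / h\<^sup>2"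
  proof -
    have "real p * h\<^sup>2 \<le> 1" using r1 by (simp add: r_def)
    then have "real p \<le> 1 / h\<^sup>2" using h by (simp add: pos_le_divide_eq)
    then show ?thesis by simp
  qed
  also have "\<dots> = (41 + 80 * pi) / h\<^sup>2" by (simp add: add_divide_distrib)
  also have "\<dots> \<le> 300 / h\<^sup>2"
    using pi_approx(2) by (intro divide_right_mono) auto
  finally show ?thesis .
qed

text \<open>The reciprocal weights sum to 1 and the one at 0 is at least |c 0|, so the remaining
  terms add up to at most 1 - |c 0| < |c 0|. This covers A < ln 2.\<close>

lemma no_zeros_if_dominant:
  assumes "norm (c 0) > 1 / 2" "norm z \<le> 1"
  shows "hasse 0 c z \<noteq> 0"
proof
  assume 0: "hasse 0 c z = 0"
  have s: "(\<lambda>n. c n * z ^ n) sums 0"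
    using hasse_sums[OF rapid_if_le_recip[OF c] assms(2), of 0] 0 by simp
  then have "(\<lambda>n. c (Suc n) * z ^ Suc n) sums (- c 0)"
    by (subst sums_Suc_iff) simp
  moreover have "(\<lambda>n. recip W (Suc n)) sums (1 - recip W 0)"
    using recip_sums by (subst sums_Suc_iff) simp
  moreover have "norm (c (Suc n) * z ^ Suc n) \<le> recip W (Suc n)" for n
  proof -
    have "norm (c (Suc n)) * norm z ^ Suc n \<le> recip W (Suc n) * 1"
      using assms(2) by (intro mult_mono c power_le_one) auto
    then show ?thesis by (simp only: norm_mult norm_power mult_1_right)
  qed
  ultimately have "norm (- c 0) \<le> 1 - recip W 0" by (rule norm_sums_le)
  with assms(1) c[of 0] show False by simp
qed

lemma zeros_le:
  assumes c0: "norm (c 0) \<ge> exp (- A)"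
    and N: "A + 3 \<le> real N" "N \<le> p" and H: "Hfun W N + 25 * sqrt A \<le> Hfun W p"
    and h: "0 < h" "h \<le> hfun W (2 * p)" "h \<le> 1 / real p"
    and F: "finite F" "F \<subseteq> cball 0 1"
    and zeros: "\<And>z k. z \<in> F \<Longrightarrow> k < \<mu> z \<Longrightarrow> hasse k c z = 0"
  shows "real (sum \<mu> F) \<le> 300 / h\<^sup>2"
proof (cases "A \<ge> ln 2")
  case True
  then show ?thesis by (rule zeros_le_of_ln2_le[OF _ c0 N H h F zeros])
next
  case False
  then have "exp (- A) > exp (- ln 2)" by simp
  moreover have "exp (- ln 2) = (1 / 2 :: real)" by (simp add: exp_minus)
  ultimately have "norm (c 0) > 1 / 2" using c0 by linarith
  then have "hasse 0 c z \<noteq> 0" if "z \<in> F" for z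
    using no_zeros_if_dominant F(2) that by auto
  then have "\<mu> z = 0" if "z \<in> F" for z using zeros[OF that, of 0] that by auto
  then have "sum \<mu> F = 0" by simp
  then show ?thesis by (simp only: of_nat_0) simp
qed

text \<open>A polynomial with more zeros than its degree vanishes. The interpolation estimate
  already gives this: beyond the degree the Hasse norm is 0, and r = 2, the diameter of the disc,
  admits all zeros.\<close>

lemma zeros_le_of_finite_support:
  assumes F: "finite F" "F \<subseteq> cball 0 1"
    and zeros: "\<And>z k. z \<in> F \<Longrightarrow> k < \<mu> z \<Longrightarrow> hasse k c z = 0"
    and nz: "norm z\<^sub>0 \<le> 1" "hasse 0 c z\<^sub>0 \<noteq> 0"
    and B: "B \<ge> 0" "\<And>n. c n \<noteq> 0 \<Longrightarrow> real n \<le> B"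
  shows "real (sum \<mu> F) \<le> B"
proof (rule ccontr)
  assume not_le: "\<not> ?thesis"
  have m: "c n = 0" if "n \<ge> sum \<mu> F" for n
  proof (rule ccontr)
    assume "c n \<noteq> 0"
    then have "real n \<le> B" by (rule B(2))
    then show False using not_le of_nat_mono[OF that, where 'a = real] by linarith
  qed
  have zero: "real (n choose sum \<mu> F) * norm (c n) = 0" for n
    using m[of n] by (cases "n < sum \<mu> F") (auto simp: binomial_eq_0)
  have "hasse_norm (sum \<mu> F) c = 0" unfolding hasse_norm_def zero by simp
  moreover have "norm (hasse 0 c z\<^sub>0) \<le> real (sum \<mu> F choose 0) * 2 ^ (sum \<mu> F - 0) * hasse_norm (sum \<mu> F) c"
  proof (rule norm_hasse_le_of_zeros[OF rapid_if_le_recip[OF c] F nz(1) _ zeros refl])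
    fix z assume "z \<in> F"
    then have "norm z \<le> 1" using F(2) by auto
    then show "dist z\<^sub>0 z \<le> 2" using norm_triangle_ineq4[of z\<^sub>0 z] nz(1) by (simp add: dist_norm)
  qed auto
  ultimately show False using nz(2) by simp
qed

end
end

section \<open>Zeros of functions in the weighted space\<close>

lemma ext_deriv_eq_hasse:
  assumes a: "rapid a" and f: "\<And>z. z \<in> ball 0 1 \<Longrightarrow> f z = hasse 0 a z" and z: "norm z \<le> 1"
  shows "ext_deriv k f z = fact k * hasse k a z"
  unfolding ext_deriv_def
proof (rule tendsto_Lim)
  show "at z within ball 0 1 \<noteq> bot"
    using z by (simp add: trivial_limit_within islimpt_ball)
  have "(hasse k a \<longlongrightarrow> hasse k a z) (at z within cball 0 1)"
    using continuous_on_hasse[OF a, of k] z by (simp add: continuous_on_def)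
  then have "((\<lambda>w. fact k * hasse k a w) \<longlongrightarrow> fact k * hasse k a z) (at z within ball 0 1)"
    by (intro tendsto_mult_left) (rule tendsto_within_subset, auto)
  moreover have "eventually (\<lambda>w. fact k * hasse k a w = (deriv ^^ k) f w) (at z within ball 0 1)"
    using higher_deriv_eq_hasse[OF a f] by (auto simp: eventually_at_filter)
  ultimately show "((deriv ^^ k) f \<longlongrightarrow> fact k * hasse k a z) (at z within ball 0 1)"
    by (rule Lim_transform_eventually)
qed

lemma ext_deriv_eq_0_of_less_zero_mult:
  "enat k < zero_mult f z \<Longrightarrow> ext_deriv k f z = 0"
  unfolding zero_mult_def by (auto split: if_splits dest: not_less_Least)

text \<open>Reduces the supremum of extended sums to finite families of natural multiplicities,
  which is the form all the estimates have.\<close>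

lemma num_zeros_le:
  assumes "\<And>F \<mu>. finite F \<Longrightarrow> F \<subseteq> cball 0 1 \<Longrightarrow> (\<And>z k. z \<in> F \<Longrightarrow> k < \<mu> z \<Longrightarrow> ext_deriv k f z = 0)
     \<Longrightarrow> sum \<mu> F \<le> n"
  shows "num_zeros f \<le> enat n"
  unfolding num_zeros_def
proof (rule SUP_least)
  fix F assume F: "F \<in> {F. finite F \<and> F \<subseteq> cball (0::complex) 1}"
  \<comment> \<open>An infinite multiplicity is cut off at n + 1. That alone would exceed the bound
    n, so it cannot occur.\<close>
  define \<mu> where "\<mu> z = (case zero_mult f z of enat m \<Rightarrow> m | \<infinity> \<Rightarrow> Suc n)" for z
  have le: "enat (\<mu> z) \<le> zero_mult f z" for z by (simp add: \<mu>_def split: enat.split)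
  have "ext_deriv k f z = 0" if "k < \<mu> z" for z k
    using that le[of z] by (intro ext_deriv_eq_0_of_less_zero_mult) (meson enat_ord_simps(2) less_le_trans)
  then have n: "sum \<mu> F \<le> n" using F by (intro assms) auto
  have "zero_mult f z = enat (\<mu> z)" if "z \<in> F" for z
  proof -
    have "\<mu> z \<le> sum \<mu> F" using F that by (intro member_le_sum) auto
    then show ?thesis using n by (auto simp: \<mu>_def split: enat.splits)
  qed
  then have "(\<Sum>z\<in>F. zero_mult f z) = (\<Sum>z\<in>F. of_nat (\<mu> z))"
    by (intro sum.cong) (auto simp: of_nat_eq_enat)
  also have "\<dots> = enat (sum \<mu> F)" by (simp only: of_nat_sum of_nat_eq_enat[symmetric])
  finally show "(\<Sum>z\<in>F. zero_mult f z) \<le> enat n" using n by simp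
qed

context moment_weight
begin

lemma taylor_coeff_le:
  assumes "weighted_norm W f = ennreal C" "C \<ge> 0"
  shows "norm (taylor_coeff f n) \<le> C * recip W n"
proof -
  let ?a = "ennreal (norm (taylor_coeff f n))"
  have le: "?a * W n \<le> ennreal C"
    unfolding assms(1)[symmetric] weighted_norm_def by (rule SUP_upper) simp
  have W0: "W n \<noteq> 0" using weight unfolding is_weight_def by (metis not_one_le_zero)
  show ?thesis
  proof (cases "W n = top")
    \<comment> \<open>An infinite weight forces the coefficient to vanish, since any nonzero
      multiple of it is infinite.\<close>
    case True
    with le have "?a = 0" by (auto simp: ennreal_mult_top top_unique split: if_splits)
    then show ?thesis using assms(2) by simp
  next
    case False
    then have "?a = ?a * W n / W n" using W0 by (simp add: mult_divide_eq_ennreal)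
    also have "\<dots> \<le> ennreal C / W n" by (rule divide_right_mono_ennreal[OF le])
    also have "\<dots> = ennreal (C * recip W n)"
      using assms(2) by (simp add: divide_ennreal_def ennreal_recip ennreal_mult)
    finally show ?thesis using assms(2) by simp
  qed
qed

lemma normalized_coefficients:
  assumes "f \<in> weighted_space W" "\<exists>z\<in>ball 0 1. f z \<noteq> 0"
    and "ennreal (exp (- A)) * weighted_norm W f \<le> ennreal (norm (f 0))"
  obtains c where "\<And>n. norm (c n) \<le> recip W n" "norm (c 0) \<ge> exp (- A)"
    and "\<exists>z. norm z \<le> 1 \<and> hasse 0 c z \<noteq> 0"
    and "\<And>k z. norm z \<le> 1 \<Longrightarrow> ext_deriv k f z = 0 \<Longrightarrow> hasse k c z = 0"
proof -
  have hol: "f holomorphic_on ball 0 1" and fin: "weighted_norm W f < \<infinity>"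
    using assms(1) by (auto simp: weighted_space_def)
  obtain C where C: "weighted_norm W f = ennreal C" "C \<ge> 0"
    using fin by (cases "weighted_norm W f") auto
  let ?a = "taylor_coeff f"
  have sums: "(\<lambda>n. ?a n * z ^ n) sums f z" if "z \<in> ball 0 1" for z
    using holomorphic_power_series[OF hol that] by (simp add: taylor_coeff_def)
  have f: "f z = hasse 0 ?a z" if "z \<in> ball 0 1" for z
    using sums[OF that] by (simp add: hasse_def sums_iff)
  have C0: "C > 0"
  proof (rule ccontr)
    assume "\<not> C > 0"
    then have "C = 0" using C(2) by simp
    then have "?a n = 0" for n using taylor_coeff_le[OF C, of n] by simp
    then have "f z = 0" if "z \<in> ball 0 1" for z using f[OF that] by (simp add: hasse_def)
    then show False using assms(2) by blast
  qed
  define c where "c n = of_real (inverse C) * ?a n" for n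
  have norm_c: "norm (c n) = norm (?a n) / C" for n
    using C0 by (simp add: c_def norm_mult norm_inverse norm_divide divide_inverse mult.commute)
  have c: "norm (c n) \<le> recip W n" for n
    unfolding norm_c using taylor_coeff_le[OF C, of n] C0 by (simp add: pos_divide_le_eq mult.commute)
  have rc: "rapid c" by (rule rapid_if_le_recip[OF c])
  have a: "?a = (\<lambda>n. of_real C * c n)" using C0 by (simp add: c_def fun_eq_iff)
  have ra: "rapid ?a" unfolding a by (rule rapid_cmult[OF rc])
  have h: "hasse k ?a z = of_real C * hasse k c z" if "norm z \<le> 1" for k z
    unfolding a by (rule hasse_cmult[OF rc that])
  show ?thesis
  proof (rule that[OF c])
    have "f 0 = ?a 0" by (simp add: taylor_coeff_def)
    moreover have "exp (- A) * C \<le> norm (f 0)"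
      using assms(3) C0 by (simp add: C(1) flip: ennreal_mult)
    ultimately show "norm (c 0) \<ge> exp (- A)" using C0 unfolding norm_c by (simp add: pos_le_divide_eq)
    obtain z where "z \<in> ball 0 1" "f z \<noteq> 0" using assms(2) by blast
    then show "\<exists>z. norm z \<le> 1 \<and> hasse 0 c z \<noteq> 0"
      using f[of z] h[of z 0] by (intro exI[of _ z]) auto
    show "hasse k c z = 0" if "norm z \<le> 1" "ext_deriv k f z = 0" for k z
      using ext_deriv_eq_hasse[OF ra f that(1), of k] that h[OF that(1), of k] C0 by simp
  qed
qed

text \<open>Divergence of the series enters here: it guarantees that the minimum defining
  \<open>Hinv\<close> is attained.\<close>

lemma Hfun_unbounded:
  assumes "(\<Sum>k. ennreal (moment W k / moment W (Suc k))) = \<infinity>"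
  shows "\<exists>p. R \<le> Hfun W p"
proof (rule ccontr)
  assume "\<not> ?thesis"
  then have less: "Hfun W p \<le> R" for p by (simp add: not_le less_imp_le)
  have "Hfun W p = (\<Sum>k<p. moment W k / moment W (Suc k))" for p
    by (induction p) (simp_all add: Hfun_def hfun_def)
  with less have "summable (\<lambda>k. moment W k / moment W (Suc k))"
    by (intro summableI_nonneg_bounded[where x = R]) (auto simp: moment_pos less_imp_le)
  then have "(\<Sum>k. ennreal (moment W k / moment W (Suc k))) = ennreal (\<Sum>k. moment W k / moment W (Suc k))"
    by (intro suminf_ennreal2) (auto simp: moment_pos less_imp_le)
  then show False using assms by simp
qed

lemma Hfun_strict_mono: "p < q \<Longrightarrow> Hfun W p < Hfun W q"
proof (induction rule: less_Suc_induct)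
  case (1 i)
  then show ?case using hfun_pos[of "Suc i"] by (simp add: Hfun_def)
qed linarith

text \<open>Monotonicity starts at index 1, so convergence is proved for the shifted sequence, which
  has the same limit.\<close>

lemma hfun_lim:
  assumes "\<And>q. q \<ge> 1 \<Longrightarrow> b < hfun W q"
  shows "b \<le> lim (hfun W)" and "q \<ge> 1 \<Longrightarrow> lim (hfun W) \<le> hfun W q"
proof -
  have "decseq (\<lambda>n. hfun W (Suc n))"
    by (rule decseq_SucI) (rule hfun_Suc_le, simp)
  moreover have "b \<le> hfun W (Suc n)" for n by (rule less_imp_le[OF assms]) simp
  ultimately obtain L where L: "(\<lambda>n. hfun W (Suc n)) \<longlonglongrightarrow> L" "\<And>n. L \<le> hfun W (Suc n)"
    using decseq_convergent by blast
  then have lim: "lim (hfun W) = L" by (intro limI) (simp add: filterlim_sequentially_Suc)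
  show "b \<le> lim (hfun W)"
    unfolding lim by (rule LIMSEQ_le_const[OF L(1)]) (use \<open>\<And>n. b \<le> hfun W (Suc n)\<close> in blast)
  show "lim (hfun W) \<le> hfun W q" if "q \<ge> 1"
    using L(2)[of "q - 1"] that by (simp add: lim)
qed

text \<open>One term of the moment gives n^(k/2) / w_n <= M_k <= l^(-k) for every k. The powers of l
  sqrt n are therefore bounded, which forces l sqrt n <= 1.\<close>

lemma index_le_of_recip_pos:
  assumes "recip W n > 0" "l > 0" "\<And>q. q \<ge> 1 \<Longrightarrow> l \<le> hfun W q"
  shows "real n \<le> 1 / l\<^sup>2"
proof -
  have "(l * sqrt (real n)) ^ k \<le> 1 / recip W n" for k
  proof -
    have "l ^ k * (sqrt (real n) ^ k * recip W n) \<le> l ^ k * moment W k"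
      using assms(2) by (intro mult_left_mono moment_ge) auto
    also have "\<dots> \<le> 1"
      using moment_add_le[of l 0 k] assms(2,3) by (cases "k = 0") (auto simp: moment_0)
    finally show ?thesis using assms(1) by (simp add: power_mult_distrib field_simps)
  qed
  then have "l * sqrt (real n) \<le> 1"
    using real_arch_pow[of "l * sqrt (real n)" "1 / recip W n"] by (meson not_le)
  then have "(l * sqrt (real n))\<^sup>2 \<le> 1\<^sup>2" using assms(2) by (intro power_mono) auto
  then show ?thesis using assms(2) by (simp add: power_mult_distrib field_simps)
qed

end

theorem proposition1:
  fixes W :: "nat \<Rightarrow> ennreal" and A :: real
  assumes "is_weight W"
    and "\<exists>n\<ge>1. W n < \<infinity>"
    and "(\<Sum>k. ennreal (moment W k / moment W (Suc k))) = \<infinity>"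
    and "A \<ge> 0"
  shows "ereal_of_enat (max_zeros W A) \<le>
    ereal (300 * hext W (2 * max (enat (pfun W A)) (hinv W (1 / real (pfun W A)))) powi (- 2))"
proof -
  interpret moment_weight W by standard fact+
  define p where "p = pfun W A"
  define N where "N = nat \<lceil>A + 3\<rceil>"
  have N: "A + 3 \<le> real N" by (simp only: N_def real_nat_ceiling_ge)
  have H: "Hfun W N + 25 * sqrt A \<le> Hfun W p"
    unfolding p_def pfun_def Hinv_def N_def using Hfun_unbounded[OF assms(3)] by (metis (mono_tags) LeastI_ex)
  moreover have "sqrt A \<ge> 0" using assms(4) by simp
  ultimately have Np: "N \<le> p" using Hfun_strict_mono[of p N] by (meson add_increasing2 leD le_cases
        linorder_not_le mult_nonneg_nonneg order_less_le_trans zero_le_numeral)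
  then have p: "real p \<ge> 3" using N assms(4) by linarith
  define h where "h = hext W (2 * max (enat p) (hinv W (1 / real p)))"
  have bound: "h > 0 \<and> real (sum \<mu> F) \<le> 300 / h\<^sup>2"
    if c: "\<And>n. norm (c n) \<le> recip W n" and c0: "norm (c 0) \<ge> exp (- A)"
      and nz: "\<exists>z. norm z \<le> 1 \<and> hasse 0 c z \<noteq> 0"
      and F: "finite F" "F \<subseteq> cball 0 1" and zeros: "\<And>z k. z \<in> F \<Longrightarrow> k < \<mu> z \<Longrightarrow> hasse k c z = 0"
    for c F \<mu>
  proof (cases "\<exists>q\<ge>1. hfun W q \<le> 1 / real p")
    case True
    define q where "q = (LEAST q. q \<ge> 1 \<and> hfun W q \<le> 1 / real p)"
    have q: "q \<ge> 1" "hfun W q \<le> 1 / real p"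
      unfolding q_def using LeastI_ex[OF True] by auto
    have "2 * max (enat p) (hinv W (1 / real p)) = enat (2 * max p q)"
      using True by (simp add: hinv_def q_def max_def numeral_eq_enat)
    then have h: "h = hfun W (2 * max p q)" by (simp add: h_def hext_def)
    have "h > 0" unfolding h by (rule hfun_pos)
    \<comment> \<open>The index 2 max(p, q) meets both demands on h: being at least 2 p it controls
      the moments up to order 2 p, and being at least q it gives h <= 1/p.\<close>
    moreover have "h \<le> hfun W (2 * p)" unfolding h using p by (intro hfun_antimono) auto
    moreover have "h \<le> 1 / real p"
      unfolding h using q by (intro order_trans[OF hfun_antimono q(2)]) auto
    ultimately show ?thesis using zeros_le[OF c c0 N Np H _ _ _ F zeros] by blast
  next
    case False
    then have "2 * max (enat p) (hinv W (1 / real p)) = \<infinity>"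
      by (simp add: hinv_def max_def numeral_eq_enat)
    then have h: "h = lim (hfun W)" by (simp add: h_def hext_def)
    \<comment> \<open>All ratios stay above 1/p, so their limit is positive and only coefficients
      with index at most 1 / h^2 survive.\<close>
    have "1 / real p < hfun W q" if "q \<ge> 1" for q using False that by (meson not_le)
    note lim = hfun_lim[OF this]
    have "0 < 1 / real p" using p by simp
    also have "\<dots> \<le> h" unfolding h by (rule lim(1))
    finally have h0: "h > 0" .
    obtain z\<^sub>0 where z0: "norm z\<^sub>0 \<le> 1" "hasse 0 c z\<^sub>0 \<noteq> 0" using nz by blast
    have "real n \<le> 1 / h\<^sup>2" if "c n \<noteq> 0" for n
    proof (rule index_le_of_recip_pos[OF _ h0])
      show "recip W n > 0" using c[of n] that by (smt (verit) zero_less_norm_iff)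
    qed (simp add: h lim(2))
    then have "real (sum \<mu> F) \<le> 1 / h\<^sup>2"
      by (intro zeros_le_of_finite_support[OF c F zeros z0]) auto
    also have "\<dots> \<le> 300 / h\<^sup>2" by (intro divide_right_mono) auto
    finally show ?thesis using h0 by blast
  qed
  \<comment> \<open>Zeros are counted in integers, so the real bound may be rounded down before the
    supremum over all functions is taken.\<close>
  define n where "n = nat \<lfloor>300 / h\<^sup>2\<rfloor>"
  have "max_zeros W A \<le> enat n"
    unfolding max_zeros_def
  proof (rule Sup_least, clarify)
    fix f z
    assume f: "f \<in> weighted_space W" "ennreal (exp (- A)) * weighted_norm W f \<le> ennreal (cmod (f 0))"
      "z \<in> ball 0 1" "f z \<noteq> 0"
    obtain c where c: "\<And>n. norm (c n) \<le> recip W n" "norm (c 0) \<ge> exp (- A)"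
      "\<exists>z. norm z \<le> 1 \<and> hasse 0 c z \<noteq> 0"
      "\<And>k z. norm z \<le> 1 \<Longrightarrow> ext_deriv k f z = 0 \<Longrightarrow> hasse k c z = 0"
      using normalized_coefficients[OF f(1) _ f(2)] f(3,4) by metis
    show "num_zeros f \<le> enat n"
    proof (rule num_zeros_le)
      fix F \<mu>
      assume F: "finite F" "F \<subseteq> cball (0::complex) 1" "\<And>z k. z \<in> F \<Longrightarrow> k < \<mu> z \<Longrightarrow> ext_deriv k f z = 0"
      have "real (sum \<mu> F) \<le> 300 / h\<^sup>2"
        using bound[OF c(1-3) F(1,2), of \<mu>] c(4) F(2,3) by (auto simp: subset_iff)
      then show "sum \<mu> F \<le> n" by (simp add: n_def le_nat_floor)
    qed
  qed
  then have "ereal_of_enat (max_zeros W A) \<le> ereal_of_enat (enat n)"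
    by (simp only: ereal_of_enat_le_iff)
  also have "\<dots> = ereal (real n)" by simp
  also have "\<dots> \<le> ereal (300 / h\<^sup>2)" by (simp add: n_def)
  also have "300 / h\<^sup>2 = 300 * h powi (- 2)" by (simp add: power_int_minus divide_inverse)
  finally show ?thesis by (simp add: h_def p_def)
qed

end
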